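(* Let $\varepsilon\in(0,\varepsilon^*]$. For $m\in\mathbb N$ let $\mathcal A_m^\varepsilon\subset\mathbb C^{2m+1}$ be the attractor of the truncated implicit Euler scheme, let $\widetilde{\mathcal A_m^\varepsilon}\subset\ell^2$ be its null-expansion, and let $\mathcal A^\varepsilon\subset\ell^2$ be the numerical attractor of the (untruncated) implicit Euler scheme $u_n^\varepsilon=u_{n-1}^\varepsilon+\varepsilon Fu_n^\varepsilon$. Then $$\lim_{m\to\infty}\mathrm{dist}_{\ell^2}\big(\widetilde{\mathcal A_m^\varepsilon},\mathcal A^\varepsilon\big)=0.$$
   Context: $\ell^2$ is the complex Hilbert space of square-summable sequences $u=(u_j)_{j\in\mathbb Z}$, $u_j\in\mathbb C$, with norm $\|\cdot\|$; $\|u\|_q^q=\sum_j|u_j|^q$. $\Lambda:\ell^2\to\ell^2$ is $(\Lambda u)_j=-u_{j-1}+2u_j-u_{j+1}$. Parameters: $\lambda,\gamma,k,p>0$, $\mu,\beta,\nu\in\mathbb R$, with $\gamma>4\lambda$; $g=(g_j)_{j\in\mathbb Z}$ is a fixed complex sequence with $\|g\|_{(p+2)/(p+1)}<\infty$ (hence $g\in\ell^2$). The vector field is $$Fu=(\lambda+i\mu)\Lambda u-(\gamma+i\beta)u-(k+i\nu)|u|^pu+g,\qquad |u|^pu=(|u_j|^pu_j)_{j\in\mathbb Z}.$$ $B_r=\{u\in\ell^2:\|u\|\le r\}$. $C_p>0$ is a constant depending only on $p$ such that $\||u|^pu-|v|^pv\|\le C_pr^p\|u-v\|$ for all $r>0$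 and $u,v\in B_r$. For $r>0$, $M_r=(4\lambda+4|\mu|+\gamma+|\beta|)r+(k+|\nu|)r^{p+1}+\|g\|$ and $L_r=4\lambda+4|\mu|+\gamma+|\beta|+C_pr^p(k+|\nu|)$. Fix $\eta\ge0$ and set $$c_1=\frac{p+1}{p+2}\,\frac{1}{[k(p+2)]^{1/(p+1)}}\,\|g\|_{\frac{p+2}{p+1}}^{\frac{p+2}{p+1}},\quad r^*=\sqrt{\eta+\frac{c_1}{\gamma-4\lambda}},\quad \varepsilon^*=\min\Big\{\frac1{M_{r^*+1}},\frac1{1+L_{r^*+1}}\Big\}.$$ For $\varepsilon\in(0,\varepsilon^*]$, $y\in B_{r^*}$ the scheme $u_n^\varepsilon=u_{n-1}^\varepsilon+\varepsilon Fu_n^\varepsilon$, $u_0^\varepsilon=y$, has a unique solution $u_n^\varepsilon(y)\in B_{r^*}$, and the numerical attractor is $\mathcal A^\varepsilon=\bigcap_{N\ge1}\overline{\bigcup_{n\ge N}u_n^\varepsilon(B_{r^*})}$ (the unique compact subset of $B_{r^*}$ invariant under $y\mapsto u^\varepsilon_n(y)$ and attracting $B_{r^*}$). Truncation: elements of $\mathbb C^{2m+1}$ are $z=(z_j)_{|j|\le m}$ with Euclidean norm; $g^m=(g_j)_{|j|\le m}$; $B_r^m$ is the closed ball of radius $r$ in $\mathbb C^{2m+1}$; $\Lambda_m$ is the periodic matrix $(\Lambda_mz)_j=-z_{j-1}+2z_j-z_{j+1}$, $|j|\le m$, with $z_{-m-1}=z_m$, $z_{m+1}=z_{-m}$. The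 truncated scheme is $$u_n^{\varepsilon,m}=u_{n-1}^{\varepsilon,m}+\varepsilon\big((\lambda+i\mu)\Lambda_mu_n^{\varepsilon,m}-(\gamma+i\beta)u_n^{\varepsilon,m}-(k+i\nu)|u_n^{\varepsilon,m}|^pu_n^{\varepsilon,m}+g^m\big),$$ which for each initial value $y\in B^m_{r^*}$ has a unique solution $u_n^{\varepsilon,m}(y)\in B^m_{r^*}$; its attractor is $\mathcal A_m^\varepsilon=\bigcap_{N\ge1}\overline{\bigcup_{n\ge N}u_n^{\varepsilon,m}(B^m_{r^*})}$. The null-expansion of $z\in\mathbb C^{2m+1}$ is $\widetilde z\in\ell^2$ with $\widetilde z_j=z_j$ for $|j|\le m$ and $\widetilde z_j=0$ for $|j|>m$; $\widetilde{\mathcal A_m^\varepsilon}=\{\widetilde z:z\in\mathcal A_m^\varepsilon\}$. $\mathrm{dist}_{\ell^2}(A,B)=\sup_{a\in A}\inf_{b\in B}\|a-b\|$. *)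

theory Defs
  imports "HOL-Analysis.Analysis"
begin

section \<open>The space of square-summable complex sequences over the integers\<close>

typedef ell2 = "{u :: int \<Rightarrow> complex. (\<lambda>j. (cmod (u j))\<^sup>2) summable_on UNIV}"
  morphisms coord Abs_ell2
  by (rule exI [of _ "\<lambda>_. 0"]) simp

setup_lifting type_definition_ell2

lemma coord_summable: "(\<lambda>j. (cmod (coord u j))\<^sup>2) summable_on UNIV"
  using coord [of u] by simp

lemma coord_Abs_ell2:
  "(\<lambda>j. (cmod (u j))\<^sup>2) summable_on UNIV \<Longrightarrow> coord (Abs_ell2 u) = u"
  by (simp add: Abs_ell2_inverse)

lemma ell2_eqI: "(\<And>j. coord u j = coord v j) \<Longrightarrow> u = v"
  by (simp add: coord_inject [symmetric] fun_eq_iff)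

lemma square_summable_add:
  fixes u v :: "int \<Rightarrow> complex"
  assumes "(\<lambda>j. (cmod (u j))\<^sup>2) summable_on UNIV" "(\<lambda>j. (cmod (v j))\<^sup>2) summable_on UNIV"
  shows "(\<lambda>j. (cmod (u j + v j))\<^sup>2) summable_on UNIV"
proof (rule summable_on_comparison_test)
  show "(\<lambda>j. 2 * ((cmod (u j))\<^sup>2 + (cmod (v j))\<^sup>2)) summable_on UNIV"
    by (intro summable_on_cmult_right summable_on_add assms)
  fix j
  have "(cmod (u j + v j))\<^sup>2 \<le> (cmod (u j) + cmod (v j))\<^sup>2"
    by (simp add: norm_triangle_ineq power_mono)
  also have "\<dots> \<le> 2 * ((cmod (u j))\<^sup>2 + (cmod (v j))\<^sup>2)"
    using sum_squares_bound [of "cmod (u j)" "cmod (v j)"] by (simp add: power2_sum)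
  finally show "(cmod (u j + v j))\<^sup>2 \<le> 2 * ((cmod (u j))\<^sup>2 + (cmod (v j))\<^sup>2)" .
qed simp

lemma square_summable_mult:
  fixes u :: "int \<Rightarrow> complex"
  assumes "(\<lambda>j. (cmod (u j))\<^sup>2) summable_on UNIV"
  shows "(\<lambda>j. (cmod (c * u j))\<^sup>2) summable_on UNIV"
  using assms by (simp add: norm_mult power_mult_distrib summable_on_cmult_right)

lemma square_summable_shift:
  fixes u :: "int \<Rightarrow> complex"
  assumes "(\<lambda>j. (cmod (u j))\<^sup>2) summable_on UNIV"
  shows "(\<lambda>j. (cmod (u (j + i)))\<^sup>2) summable_on UNIV"
proof -
  have "bij_betw (\<lambda>j::int. j + i) UNIV UNIV"
    by (rule bij_betw_byWitness [of _ "\<lambda>j. j - i"]) auto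
  from summable_on_reindex_bij_betw [OF this, of "\<lambda>j. (cmod (u j))\<^sup>2"] assms
  show ?thesis by simp
qed

lemma inner_summable: "(\<lambda>j. inner (coord u j) (coord v j)) summable_on UNIV"
proof -
  have "(\<lambda>j. norm (inner (coord u j) (coord v j))) summable_on UNIV"
  proof (rule Infinite_Sum.abs_summable_on_comparison_test')
    show "(\<lambda>j. (cmod (coord u j))\<^sup>2 + (cmod (coord v j))\<^sup>2) summable_on UNIV"
      by (intro summable_on_add coord_summable)
    fix j
    have "norm (inner (coord u j) (coord v j)) \<le> cmod (coord u j) * cmod (coord v j)"
      by (simp add: Cauchy_Schwarz_ineq2)
    also have "\<dots> \<le> (cmod (coord u j))\<^sup>2 + (cmod (coord v j))\<^sup>2"
    proof -
      have "0 \<le> cmod (coord u j) * cmod (coord v j)" by simp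
      with sum_squares_bound [of "cmod (coord u j)" "cmod (coord v j)"] show ?thesis by linarith
    qed
    finally show "norm (inner (coord u j) (coord v j)) \<le> (cmod (coord u j))\<^sup>2 + (cmod (coord v j))\<^sup>2" .
  qed
  then show ?thesis by (rule abs_summable_summable)
qed

instantiation ell2 :: real_vector
begin

lift_definition zero_ell2 :: ell2 is "\<lambda>_. 0" by simp

lift_definition plus_ell2 :: "ell2 \<Rightarrow> ell2 \<Rightarrow> ell2" is "\<lambda>u v j. u j + v j"
  by (rule square_summable_add)

lift_definition uminus_ell2 :: "ell2 \<Rightarrow> ell2" is "\<lambda>u j. - u j" by simp

lift_definition minus_ell2 :: "ell2 \<Rightarrow> ell2 \<Rightarrow> ell2" is "\<lambda>u v j. u j - v j"
  using square_summable_add [of _ "\<lambda>j. - _ j"] by simp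

lift_definition scaleR_ell2 :: "real \<Rightarrow> ell2 \<Rightarrow> ell2" is "\<lambda>c u j. c *\<^sub>R u j"
  using square_summable_mult [of _ "complex_of_real _"] by (simp add: scaleR_conv_of_real)

instance
proof
  fix a b :: real and u v w :: ell2
  show "u + v + w = u + (v + w)" by transfer (simp add: add.assoc)
  show "u + v = v + u" by transfer (simp add: add.commute)
  show "0 + u = u" by transfer simp
  show "- u + u = 0" by transfer simp
  show "u - v = u + - v" by transfer simp
  show "a *\<^sub>R (u + v) = a *\<^sub>R u + a *\<^sub>R v" by transfer (simp add: scaleR_right_distrib)
  show "(a + b) *\<^sub>R u = a *\<^sub>R u + b *\<^sub>R u" by transfer (simp add: scaleR_left_distrib)
  show "a *\<^sub>R b *\<^sub>R u = (a * b) *\<^sub>R u" by transfer simp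
  show "1 *\<^sub>R u = u" by transfer simp
qed

end

instantiation ell2 :: real_inner
begin

text \<open>The real part of the usual complex inner product.\<close>

definition inner_ell2 :: "ell2 \<Rightarrow> ell2 \<Rightarrow> real"
  where "inner_ell2 u v = (\<Sum>\<^sub>\<infinity>j. inner (coord u j) (coord v j))"

definition norm_ell2 :: "ell2 \<Rightarrow> real"
  where "norm_ell2 u = sqrt (\<Sum>\<^sub>\<infinity>j. (cmod (coord u j))\<^sup>2)"

definition sgn_ell2 :: "ell2 \<Rightarrow> ell2"
  where "sgn_ell2 u = u /\<^sub>R norm u"

definition dist_ell2 :: "ell2 \<Rightarrow> ell2 \<Rightarrow> real"
  where "dist_ell2 u v = norm (u - v)"

definition uniformity_ell2 :: "(ell2 \<times> ell2) filter"
  where "uniformity_ell2 = (INF e\<in>{0<..}. principal {(u, v). dist u v < e})"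

definition open_ell2 :: "ell2 set \<Rightarrow> bool"
  where "open_ell2 U = (\<forall>x\<in>U. \<forall>\<^sub>F (x', y) in uniformity. x' = x \<longrightarrow> y \<in> U)"

instance
proof
  fix a :: real and u v w :: ell2 and U :: "ell2 set"
  show "sgn u = u /\<^sub>R norm u" by (fact sgn_ell2_def)
  show "dist u v = norm (u - v)" by (fact dist_ell2_def)
  show "(uniformity :: (ell2 \<times> ell2) filter) = (INF e\<in>{0<..}. principal {(u, v). dist u v < e})"
    by (fact uniformity_ell2_def)
  show "open U = (\<forall>x\<in>U. \<forall>\<^sub>F (x', y) in uniformity. x' = x \<longrightarrow> y \<in> U)"
    by (fact open_ell2_def)
  show "inner u v = inner v u" by (simp add: inner_ell2_def inner_commute)
  show "inner (u + v) w = inner u w + inner v w"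
    by (simp add: inner_ell2_def plus_ell2.rep_eq inner_add_left infsum_add inner_summable)
  show "inner (a *\<^sub>R u) v = a * inner u v"
    by (simp add: inner_ell2_def scaleR_ell2.rep_eq infsum_cmult_right')
  show "0 \<le> inner u u" by (simp add: inner_ell2_def infsum_nonneg)
  show "inner u u = 0 \<longleftrightarrow> u = 0"
  proof
    assume "inner u u = 0"
    then have le: "(\<Sum>\<^sub>\<infinity>j. inner (coord u j) (coord u j)) \<le> 0" by (simp add: inner_ell2_def)
    have "inner (coord u j) (coord u j) = 0" for j
      by (rule nonneg_infsum_le_0D [OF le inner_summable]) auto
    then show "u = 0" by (intro ell2_eqI) (simp add: zero_ell2.rep_eq)
  next
    assume "u = 0"
    then show "inner u u = 0" by (simp add: inner_ell2_def zero_ell2.rep_eq)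
  qed
  show "norm u = sqrt (inner u u)"
    by (simp add: norm_ell2_def inner_ell2_def power2_norm_eq_inner)
qed

end

text \<open>Multiplication by a complex scalar.\<close>

lift_definition scaleC :: "complex \<Rightarrow> ell2 \<Rightarrow> ell2"  (infixr \<open>*\<^sub>C\<close> 75) is "\<lambda>c u j. c * u j"
  by (rule square_summable_mult)


section \<open>The vector field\<close>

lift_definition Lap :: "ell2 \<Rightarrow> ell2" is "\<lambda>u j. - u (j - 1) + 2 * u j - u (j + 1)"
proof -
  fix u :: "int \<Rightarrow> complex"
  assume u: "(\<lambda>j. (cmod (u j))\<^sup>2) summable_on UNIV"
  have "(\<lambda>j. (cmod ((- 1 * u (j + (- 1)) + 2 * u j) + - 1 * u (j + 1)))\<^sup>2) summable_on UNIV"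
    by (intro square_summable_add square_summable_mult square_summable_shift u)
  then show "(\<lambda>j. (cmod (- u (j - 1) + 2 * u j - u (j + 1)))\<^sup>2) summable_on UNIV" by simp
qed

text \<open>
  The map taking \<open>u\<close> to the sequence with entries \<open>|u\<^sub>j|\<^sup>p u\<^sub>j\<close>. For \<open>p \<ge> 0\<close> this
  sequence is again square-summable (lemma \<open>coord_nonlin\<close>), so the use of
  \<^const>\<open>Abs_ell2\<close> is legitimate.
\<close>

definition nonlin :: "real \<Rightarrow> ell2 \<Rightarrow> ell2"
  where "nonlin p u = Abs_ell2 (\<lambda>j. complex_of_real (cmod (coord u j) powr p) * coord u j)"

lemma coord_le_norm: "cmod (coord u j) \<le> norm u"
proof -
  have "(\<Sum>i\<in>{j}. (cmod (coord u i))\<^sup>2) \<le> (\<Sum>\<^sub>\<infinity>i. (cmod (coord u i))\<^sup>2)"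
    by (rule finite_sum_le_infsum [OF coord_summable]) auto
  then have "sqrt ((cmod (coord u j))\<^sup>2) \<le> norm u"
    unfolding norm_ell2_def by (intro real_sqrt_le_mono) simp
  then show ?thesis by simp
qed

lemma coord_nonlin:
  assumes "p \<ge> 0"
  shows "coord (nonlin p u) j = complex_of_real (cmod (coord u j) powr p) * coord u j"
proof -
  have "(\<lambda>j. (cmod (complex_of_real (cmod (coord u j) powr p) * coord u j))\<^sup>2) summable_on UNIV"
  proof (rule summable_on_comparison_test)
    show "(\<lambda>j. (norm u powr p)\<^sup>2 * (cmod (coord u j))\<^sup>2) summable_on UNIV"
      by (intro summable_on_cmult_right coord_summable)
    fix j
    have "cmod (coord u j) powr p \<le> norm u powr p"
      by (intro powr_mono2 coord_le_norm assms) simp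
    then show "(cmod (complex_of_real (cmod (coord u j) powr p) * coord u j))\<^sup>2
        \<le> (norm u powr p)\<^sup>2 * (cmod (coord u j))\<^sup>2"
      by (simp add: norm_mult power_mult_distrib mult_right_mono power_mono)
  qed simp
  then show ?thesis by (simp add: nonlin_def coord_Abs_ell2)
qed

definition field ::
    "real \<Rightarrow> real \<Rightarrow> real \<Rightarrow> real \<Rightarrow> real \<Rightarrow> real \<Rightarrow> real \<Rightarrow> ell2 \<Rightarrow> ell2 \<Rightarrow> ell2"
  where "field lam \<mu> \<gamma> \<beta> k \<nu> p g u =
    Complex lam \<mu> *\<^sub>C Lap u - Complex \<gamma> \<beta> *\<^sub>C u - Complex k \<nu> *\<^sub>C nonlin p u + g"

text \<open>
  A sequence whose \<open>q\<close>-th powers are summable for some \<open>0 < q \<le> 2\<close> is square-summable; it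
  applies to the forcing term with \<open>q = (p + 2) / (p + 1)\<close>.
\<close>

lemma coord_Abs_ell2_of_powr_summable:
  fixes g :: "int \<Rightarrow> complex"
  assumes q: "0 < q" "q \<le> 2" and g: "(\<lambda>j. cmod (g j) powr q) summable_on UNIV"
  shows "coord (Abs_ell2 g) = g"
proof (rule coord_Abs_ell2, rule summable_on_comparison_test)
  define S where "S = (\<Sum>\<^sub>\<infinity>j. cmod (g j) powr q)"
  show "(\<lambda>j. S powr ((2 - q) / q) * cmod (g j) powr q) summable_on UNIV"
    by (intro summable_on_cmult_right g)
  fix j
  have "(\<Sum>i\<in>{j}. cmod (g i) powr q) \<le> S"
    unfolding S_def by (rule finite_sum_le_infsum [OF g]) auto
  then have "cmod (g j) powr q \<le> S" by simp
  then have "(cmod (g j) powr q) powr ((2 - q) / q) \<le> S powr ((2 - q) / q)"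
    using q by (intro powr_mono2) auto
  then have le: "cmod (g j) powr (2 - q) \<le> S powr ((2 - q) / q)"
    using q by (simp add: powr_powr)
  have "(cmod (g j))\<^sup>2 = cmod (g j) powr (2 - q) * cmod (g j) powr q"
    by (cases "g j = 0") (simp_all flip: powr_add)
  also have "\<dots> \<le> S powr ((2 - q) / q) * cmod (g j) powr q"
    by (intro mult_right_mono le) simp
  finally show "(cmod (g j))\<^sup>2 \<le> S powr ((2 - q) / q) * cmod (g j) powr q" .
qed simp


section \<open>Constants\<close>

definition M_const ::
    "real \<Rightarrow> real \<Rightarrow> real \<Rightarrow> real \<Rightarrow> real \<Rightarrow> real \<Rightarrow> real \<Rightarrow> ell2 \<Rightarrow> real \<Rightarrow> real"
  where "M_const lam \<mu> \<gamma> \<beta> k \<nu> p g r =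
    (4 * lam + 4 * \<bar>\<mu>\<bar> + \<gamma> + \<bar>\<beta>\<bar>) * r + (k + \<bar>\<nu>\<bar>) * r powr (p + 1) + norm g"

definition L_const ::
    "real \<Rightarrow> real \<Rightarrow> real \<Rightarrow> real \<Rightarrow> real \<Rightarrow> real \<Rightarrow> real \<Rightarrow> real \<Rightarrow> real \<Rightarrow> real"
  where "L_const lam \<mu> \<gamma> \<beta> k \<nu> p Cp r =
    4 * lam + 4 * \<bar>\<mu>\<bar> + \<gamma> + \<bar>\<beta>\<bar> + Cp * r powr p * (k + \<bar>\<nu>\<bar>)"

definition c1_const :: "real \<Rightarrow> real \<Rightarrow> (int \<Rightarrow> complex) \<Rightarrow> real"
  where "c1_const k p g =
    (p + 1) / (p + 2) * (1 / (k * (p + 2)) powr (1 / (p + 1)))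
      * (\<Sum>\<^sub>\<infinity>j. cmod (g j) powr ((p + 2) / (p + 1)))"

definition r_star :: "real \<Rightarrow> real \<Rightarrow> real \<Rightarrow> real \<Rightarrow> (int \<Rightarrow> complex) \<Rightarrow> real \<Rightarrow> real"
  where "r_star lam \<gamma> k p g \<eta> = sqrt (\<eta> + c1_const k p g / (\<gamma> - 4 * lam))"

definition eps_star ::
    "real \<Rightarrow> real \<Rightarrow> real \<Rightarrow> real \<Rightarrow> real \<Rightarrow> real \<Rightarrow> real \<Rightarrow> (int \<Rightarrow> complex) \<Rightarrow> real \<Rightarrow> real \<Rightarrow> real"
  where "eps_star lam \<mu> \<gamma> \<beta> k \<nu> p g Cp \<eta> =
    (let r = r_star lam \<gamma> k p g \<eta> + 1
     in min (1 / M_const lam \<mu> \<gamma> \<beta> k \<nu> p (Abs_ell2 g) r)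
            (1 / (1 + L_const lam \<mu> \<gamma> \<beta> k \<nu> p Cp r)))"


section \<open>Implicit Euler schemes and their attractors\<close>

text \<open>
  In \<open>attractor_of T S B\<close>, \<open>S n y\<close> is the state after \<open>n\<close> steps from the initial value \<open>y\<close>
  and closures are taken in the topology \<open>T\<close>.
\<close>

definition attractor_of :: "'a topology \<Rightarrow> (nat \<Rightarrow> 'a \<Rightarrow> 'a) \<Rightarrow> 'a set \<Rightarrow> 'a set"
  where "attractor_of T S B = (\<Inter>N\<in>{1..}. T closure_of (\<Union>n\<in>{N..}. S n ` B))"

text \<open>
  The \<open>n\<close>-th term of the solution, unique among sequences staying in \<open>B\<close>, of the implicit
  Euler scheme with step size \<open>\<epsilon>\<close> for the vector field \<open>F\<close>, started at \<open>y\<close>.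
\<close>

definition euler :: "(ell2 \<Rightarrow> ell2) \<Rightarrow> ell2 set \<Rightarrow> real \<Rightarrow> nat \<Rightarrow> ell2 \<Rightarrow> ell2"
  where "euler F B \<epsilon> n y =
    (THE u. u 0 = y \<and> (\<forall>n. u n \<in> B) \<and> (\<forall>n\<ge>1. u n = u (n - 1) + \<epsilon> *\<^sub>R F (u n))) n"

definition num_attractor ::
    "real \<Rightarrow> real \<Rightarrow> real \<Rightarrow> real \<Rightarrow> real \<Rightarrow> real \<Rightarrow> real \<Rightarrow> (int \<Rightarrow> complex) \<Rightarrow> real \<Rightarrow> real \<Rightarrow> ell2 set"
  where "num_attractor lam \<mu> \<gamma> \<beta> k \<nu> p g \<eta> \<epsilon> =
    (let B = cball 0 (r_star lam \<gamma> k p g \<eta>)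
     in attractor_of euclidean (euler (field lam \<mu> \<gamma> \<beta> k \<nu> p (Abs_ell2 g)) B \<epsilon>) B)"


section \<open>Truncation\<close>

text \<open>
  \<open>\<complex>\<^sup>2\<^sup>m\<^sup>+\<^sup>1\<close> consists of the functions on \<open>{-m..m}\<close>, represented in the usual extensional way
  (value \<^const>\<open>undefined\<close> outside of \<open>{-m..m}\<close>), with the Euclidean distance.
\<close>

definition idx :: "nat \<Rightarrow> int set"
  where "idx m = {- int m..int m}"

definition trunc_space :: "nat \<Rightarrow> (int \<Rightarrow> complex) set"
  where "trunc_space m = (idx m \<rightarrow>\<^sub>E UNIV)"

definition trunc_dist :: "nat \<Rightarrow> (int \<Rightarrow> complex) \<Rightarrow> (int \<Rightarrow> complex) \<Rightarrow> real"
  where "trunc_dist m z w = L2_set (\<lambda>j. cmod (z j - w j)) (idx m)"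

lemma Metric_space_trunc: "Metric_space (trunc_space m) (trunc_dist m)"
proof
  fix x y z :: "int \<Rightarrow> complex"
  show "0 \<le> trunc_dist m x y" by (simp add: trunc_dist_def)
  show "trunc_dist m x y = trunc_dist m y x" by (simp add: trunc_dist_def norm_minus_commute)
  show "trunc_dist m x y = 0 \<longleftrightarrow> x = y" if "x \<in> trunc_space m" "y \<in> trunc_space m"
  proof -
    have "trunc_dist m x y = 0 \<longleftrightarrow> (\<forall>j\<in>idx m. x j = y j)"
      by (simp add: trunc_dist_def L2_set_eq_0_iff idx_def)
    also have "\<dots> \<longleftrightarrow> x = y"
      using that PiE_ext [of x "idx m" "\<lambda>_. UNIV" y] by (auto simp: trunc_space_def)
    finally show ?thesis .
  qed
  show "trunc_dist m x z \<le> trunc_dist m x y + trunc_dist m y z"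
    unfolding trunc_dist_def
    by (rule order_trans [OF _ L2_set_triangle_ineq])
      (auto intro!: L2_set_mono norm_diff_triangle_ineq norm_diff_triangle_le)
qed

definition trunc_topology :: "nat \<Rightarrow> (int \<Rightarrow> complex) topology"
  where "trunc_topology m = Metric_space.mtopology (trunc_space m) (trunc_dist m)"

definition trunc_ball :: "nat \<Rightarrow> real \<Rightarrow> (int \<Rightarrow> complex) set"
  where "trunc_ball m r = {z \<in> trunc_space m. L2_set (\<lambda>j. cmod (z j)) (idx m) \<le> r}"

text \<open>
  Only the components with index in \<open>idx m\<close> of the results of \<open>trunc_Lap\<close> and \<open>trunc_field\<close>
  are meaningful.
\<close>

definition trunc_Lap :: "nat \<Rightarrow> (int \<Rightarrow> complex) \<Rightarrow> int \<Rightarrow> complex"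
  where "trunc_Lap m z j =
    - (if j = - int m then z (int m) else z (j - 1)) + 2 * z j
    - (if j = int m then z (- int m) else z (j + 1))"

definition trunc_field ::
    "real \<Rightarrow> real \<Rightarrow> real \<Rightarrow> real \<Rightarrow> real \<Rightarrow> real \<Rightarrow> real \<Rightarrow> (int \<Rightarrow> complex) \<Rightarrow> nat
      \<Rightarrow> (int \<Rightarrow> complex) \<Rightarrow> int \<Rightarrow> complex"
  where "trunc_field lam \<mu> \<gamma> \<beta> k \<nu> p g m z j =
    Complex lam \<mu> * trunc_Lap m z j - Complex \<gamma> \<beta> * z j
    - Complex k \<nu> * (complex_of_real (cmod (z j) powr p) * z j) + g j"

definition trunc_euler ::
    "nat \<Rightarrow> ((int \<Rightarrow> complex) \<Rightarrow> int \<Rightarrow> complex) \<Rightarrow> (int \<Rightarrow> complex) set \<Rightarrow> real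
      \<Rightarrow> nat \<Rightarrow> (int \<Rightarrow> complex) \<Rightarrow> int \<Rightarrow> complex"
  where "trunc_euler m F B \<epsilon> n y =
    (THE z. z 0 = y \<and> (\<forall>n. z n \<in> B) \<and>
      (\<forall>n\<ge>1. \<forall>j\<in>idx m. z n j = z (n - 1) j + complex_of_real \<epsilon> * F (z n) j)) n"

definition trunc_attractor ::
    "real \<Rightarrow> real \<Rightarrow> real \<Rightarrow> real \<Rightarrow> real \<Rightarrow> real \<Rightarrow> real \<Rightarrow> (int \<Rightarrow> complex) \<Rightarrow> real \<Rightarrow> real \<Rightarrow> nat
      \<Rightarrow> (int \<Rightarrow> complex) set"
  where "trunc_attractor lam \<mu> \<gamma> \<beta> k \<nu> p g \<eta> \<epsilon> m =
    (let B = trunc_ball m (r_star lam \<gamma> k p g \<eta>)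
     in attractor_of (trunc_topology m)
          (trunc_euler m (trunc_field lam \<mu> \<gamma> \<beta> k \<nu> p g m) B \<epsilon>) B)"

lift_definition null_expansion :: "nat \<Rightarrow> (int \<Rightarrow> complex) \<Rightarrow> ell2"
  is "\<lambda>m z j. if j \<in> idx m then z j else 0"
proof -
  fix m and z :: "int \<Rightarrow> complex"
  have "(\<lambda>j. (cmod (if j \<in> idx m then z j else 0))\<^sup>2) summable_on idx m"
    by (rule summable_on_finite) (simp add: idx_def)
  then show "(\<lambda>j. (cmod (if j \<in> idx m then z j else 0))\<^sup>2) summable_on UNIV"
    by (rule summable_on_cong_neutral [THEN iffD1, rotated -1]) auto
qed

text \<open>
  Extended-real valued, so that suprema and infima of arbitrary sets are the true ones.
\<close>

definition semidist :: "'a::metric_space set \<Rightarrow> 'a set \<Rightarrow> ereal"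
  where "semidist A B = (SUP a\<in>A. INF b\<in>B. ereal (dist a b))"

end

theory Submission
  imports Defs
begin

text \<open>
  Null-expansion turns the truncated scheme into an implicit Euler scheme on \<open>\<ell>\<^sup>2\<close> itself, with the
  shift of the sites replaced by the cyclic shift of the window \<open>{-m..m}\<close> and with the forcing
  cut off. Truncated and full schemes are then members of one family of systems, indexed by a
  bijection of the sites and a forcing dominated by \<open>g\<close>, and all estimates are uniform over it.

  The central estimate (\<open>weighted_energy_estimate\<close>) bounds the weighted mass
  \<open>\<Sum>j. \<theta> j * \<bar>u j\<bar>\<^sup>2\<close> after one step by \<open>1 / (1 + 2 * \<epsilon> * (\<gamma> - 4 * lam))\<close> times the mass before it plus a
  source, which consists of the weighted forcing and of the variation of \<open>\<theta>\<close> between neighbouring sites.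
  With the weight \<open>1\<close> it makes the ball of radius \<open>r\<^sup>*\<close> invariant, which together with a contraction
  argument makes each step a well-defined map of the ball. With an even cutoff at distance \<open>K\<close>, whose
  variation is at most \<open>1 / K\<close> also across the periodic boundary, it shows that long orbits have
  tails that are small uniformly in \<open>m\<close> (\<open>orbit_tails_small\<close>). Bounded sequences with uniformly
  small tails have convergent subsequences (\<open>ell2_convergent_subseq\<close>). So the family of truncated
  schemes is asymptotically compact, uniformly in \<open>m\<close>.

  One step of the truncated scheme converges to one step of the full scheme along convergent initial
  values (\<open>trunc_step_tendsto\<close>). Asymptotic compactness and convergence of the maps imply upper
  semicontinuity of the limit sets (\<open>limit_set_semicontinuous\<close>): a limit of points of truncated
  attractors has, for each \<open>N\<close>, a preimage in the ball under \<open>N\<close> steps of the full scheme, so it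
  belongs to the numerical attractor.
\<close>

section \<open>Weighted square sums, completeness and compactness\<close>

lemma coord_simps [simp]:
  "coord 0 j = 0" "coord (u + v) j = coord u j + coord v j" "coord (u - v) j = coord u j - coord v j"
  "coord (- u) j = - coord u j" "coord (r *\<^sub>R u) j = complex_of_real r * coord u j"
  "coord (c *\<^sub>C u) j = c * coord u j"
  by (simp_all add: zero_ell2.rep_eq plus_ell2.rep_eq minus_ell2.rep_eq uminus_ell2.rep_eq
      scaleR_ell2.rep_eq scaleC.rep_eq scaleR_conv_of_real)

lemma coord_null_expansion [simp]: "coord (null_expansion m z) j = (if j \<in> idx m then z j else 0)"
  by (simp add: null_expansion.rep_eq)

lemma norm_ell2_has_sum: "((\<lambda>j. (cmod (coord u j))\<^sup>2) has_sum (norm u)\<^sup>2) UNIV"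
  using has_sum_infsum [OF coord_summable, of u] by (simp add: norm_ell2_def infsum_nonneg)

lemma norm_scaleC: "norm (c *\<^sub>C u) = cmod c * norm u"
proof -
  have "((\<lambda>j. (cmod c)\<^sup>2 * (cmod (coord u j))\<^sup>2) has_sum (cmod c)\<^sup>2 * (norm u)\<^sup>2) UNIV"
    by (intro has_sum_cmult_right norm_ell2_has_sum)
  moreover have "((\<lambda>j. (cmod c)\<^sup>2 * (cmod (coord u j))\<^sup>2) has_sum (norm (c *\<^sub>C u))\<^sup>2) UNIV"
    using norm_ell2_has_sum [of "c *\<^sub>C u"] by (simp add: norm_mult power_mult_distrib)
  ultimately have "(norm (c *\<^sub>C u))\<^sup>2 = (cmod c * norm u)\<^sup>2"
    unfolding power_mult_distrib by (rule has_sum_unique [rotated])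
  then show ?thesis by (simp add: power2_eq_iff_nonneg)
qed

lemma scaleC_diff: "c *\<^sub>C (u - v) = c *\<^sub>C u - c *\<^sub>C v"
  by (rule ell2_eqI) (simp add: algebra_simps)

lemma norm_mono_coord:
  assumes "\<And>j. cmod (coord u j) \<le> C * cmod (coord v j)" and "0 \<le> C"
  shows "norm u \<le> C * norm v"
proof -
  have "(norm u)\<^sup>2 \<le> C\<^sup>2 * (norm v)\<^sup>2"
  proof (rule has_sum_mono [OF norm_ell2_has_sum has_sum_cmult_right [OF norm_ell2_has_sum]])
    fix j
    show "(cmod (coord u j))\<^sup>2 \<le> C\<^sup>2 * (cmod (coord v j))\<^sup>2"
      using power_mono [OF assms(1) [of j], of 2] by (simp add: power_mult_distrib)
  qed
  then have "(norm u)\<^sup>2 \<le> (C * norm v)\<^sup>2" by (simp add: power_mult_distrib)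
  then show ?thesis by (rule power2_le_imp_le) (simp add: assms)
qed

text \<open>
  Three sizes are of this form: the weight \<open>1\<close> gives the squared norm, the indicator of the
  complement of a finite set gives a tail, and a slowly growing weight gives a cutoff that is
  compatible with the difference operator.
\<close>
definition wsum :: "(int \<Rightarrow> real) \<Rightarrow> ell2 \<Rightarrow> real"
  where "wsum \<theta> u = (\<Sum>\<^sub>\<infinity>j. \<theta> j * (cmod (coord u j))\<^sup>2)"

lemma wsum_has_sum:
  assumes "\<And>j. 0 \<le> \<theta> j" "\<And>j. \<theta> j \<le> 1"
  shows "((\<lambda>j. \<theta> j * (cmod (coord u j))\<^sup>2) has_sum wsum \<theta> u) UNIV"
  unfolding wsum_def
proof (rule has_sum_infsum, rule summable_on_comparison_test [OF coord_summable])
  show "\<theta> j * (cmod (coord u j))\<^sup>2 \<le> (cmod (coord u j))\<^sup>2" for j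
    using mult_right_mono [OF assms(2), of "(cmod (coord u j))\<^sup>2" j] by simp
qed (simp add: assms)

lemma wsum_one: "wsum (\<lambda>_. 1) u = (norm u)\<^sup>2"
  unfolding wsum_def using norm_ell2_has_sum [THEN infsumI, of u] by simp

lemma wsum_mono:
  assumes "\<And>j. 0 \<le> \<theta> j" "\<And>j. \<theta> j \<le> \<theta>' j" "\<And>j. \<theta>' j \<le> 1"
  shows "wsum \<theta> u \<le> wsum \<theta>' u"
  using assms order_trans [OF assms(2,3)] order_trans [OF assms(1,2)]
  by (intro has_sum_mono [OF wsum_has_sum wsum_has_sum]) (auto intro: mult_right_mono)

lemma wsum_nonneg: "(\<And>j. 0 \<le> \<theta> j) \<Longrightarrow> 0 \<le> wsum \<theta> u"
  unfolding wsum_def by (intro infsum_nonneg) simp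

lemma wsum_le_norm:
  assumes "\<And>j. 0 \<le> \<theta> j" "\<And>j. \<theta> j \<le> 1"
  shows "wsum \<theta> u \<le> (norm u)\<^sup>2"
  using wsum_mono [of \<theta> "\<lambda>_. 1" u] assms by (simp add: wsum_one)

lemma wsum_diff_le:
  assumes "\<And>j. 0 \<le> \<theta> j" "\<And>j. \<theta> j \<le> 1"
  shows "wsum \<theta> (u - v) \<le> 2 * wsum \<theta> u + 2 * wsum \<theta> v"
proof (rule has_sum_mono [OF wsum_has_sum])
  show "((\<lambda>j. 2 * (\<theta> j * (cmod (coord u j))\<^sup>2) + 2 * (\<theta> j * (cmod (coord v j))\<^sup>2))
          has_sum (2 * wsum \<theta> u + 2 * wsum \<theta> v)) UNIV"
    by (intro has_sum_add has_sum_cmult_right wsum_has_sum assms)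
  fix j
  have "(cmod (coord u j - coord v j))\<^sup>2 \<le> (cmod (coord u j) + cmod (coord v j))\<^sup>2"
    by (simp add: norm_triangle_ineq4 power_mono)
  also have "\<dots> \<le> 2 * (cmod (coord u j))\<^sup>2 + 2 * (cmod (coord v j))\<^sup>2"
    using sum_squares_bound [of "cmod (coord u j)" "cmod (coord v j)"] by (simp add: power2_sum)
  finally show "\<theta> j * (cmod (coord (u - v) j))\<^sup>2
      \<le> 2 * (\<theta> j * (cmod (coord u j))\<^sup>2) + 2 * (\<theta> j * (cmod (coord v j))\<^sup>2)"
    using mult_left_mono [OF _ assms(1) [of j]] by (fastforce simp: algebra_simps)
qed (use assms in auto)

abbreviation tail :: "int set \<Rightarrow> ell2 \<Rightarrow> real"
  where "tail J \<equiv> wsum (indicat_real (- J))"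

lemma norm_split_tail:
  assumes "finite J"
  shows "(norm u)\<^sup>2 = (\<Sum>j\<in>J. (cmod (coord u j))\<^sup>2) + tail J u"
proof -
  have "((\<lambda>j. indicat_real J j * (cmod (coord u j))\<^sup>2) has_sum (\<Sum>j\<in>J. (cmod (coord u j))\<^sup>2)) UNIV"
    by (rule has_sum_finite_neutralI [OF assms]) (auto simp: indicator_def)
  then have "((\<lambda>j. indicat_real J j * (cmod (coord u j))\<^sup>2 + indicat_real (- J) j * (cmod (coord u j))\<^sup>2)
      has_sum ((\<Sum>j\<in>J. (cmod (coord u j))\<^sup>2) + tail J u)) UNIV"
    by (intro has_sum_add wsum_has_sum) (auto simp: indicator_def)
  moreover have "indicat_real J j * a + indicat_real (- J) j * a = a" for j a
    by (simp add: indicator_def)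
  ultimately have "((\<lambda>j. (cmod (coord u j))\<^sup>2) has_sum
      ((\<Sum>j\<in>J. (cmod (coord u j))\<^sup>2) + tail J u)) UNIV" by simp
  then show ?thesis by (rule has_sum_unique [OF norm_ell2_has_sum])
qed

lemma tail_antimono: "J \<subseteq> J' \<Longrightarrow> tail J' u \<le> tail J u"
  by (intro wsum_mono) (auto simp: indicator_def)

lemma tail_small:
  assumes "0 < e"
  shows "\<exists>J. finite J \<and> tail J u < e"
proof -
  from norm_ell2_has_sum [of u] assms
  have "\<exists>J. finite J \<and> dist (\<Sum>j\<in>J. (cmod (coord u j))\<^sup>2) ((norm u)\<^sup>2) \<le> e / 2"
    using has_sum_finite_approximation [of _ UNIV "(norm u)\<^sup>2" "e / 2"] by auto
  then obtain J where "finite J" "dist (\<Sum>j\<in>J. (cmod (coord u j))\<^sup>2) ((norm u)\<^sup>2) \<le> e / 2"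
    by blast
  with norm_split_tail [of J u] assms show ?thesis
    by (intro exI [of _ J]) (auto simp: dist_real_def)
qed

lemma coord_tendsto: "x \<longlonglongrightarrow> a \<Longrightarrow> (\<lambda>i. coord (x i) j) \<longlonglongrightarrow> coord a j"
proof -
  assume "x \<longlonglongrightarrow> a"
  then have "(\<lambda>i. norm (x i - a)) \<longlonglongrightarrow> 0"
    by (simp add: LIM_zero tendsto_norm_zero)
  then have "(\<lambda>i. coord (x i) j - coord a j) \<longlonglongrightarrow> 0"
  proof (rule Lim_null_comparison [rotated])
    have "cmod (coord (x i) j - coord a j) \<le> norm (x i - a)" for i
      using coord_le_norm [of "x i - a" j] by simp
    then show "\<forall>\<^sub>F i in sequentially. cmod (coord (x i) j - coord a j) \<le> norm (x i - a)" by simp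
  qed
  then show ?thesis by (simp add: LIM_zero_iff)
qed

text \<open>
  Outside a large finite set the limit and the late terms carry little mass, and on a finite
  set coordinatewise convergence is norm convergence.
\<close>

lemma tendsto_ell2I:
  assumes coord: "\<And>j. (\<lambda>i. coord (x i) j) \<longlonglongrightarrow> coord a j"
    and tails: "\<And>e. 0 < e \<Longrightarrow> \<exists>J. finite J \<and> (\<forall>\<^sub>F i in sequentially. tail J (x i) \<le> e)"
  shows "x \<longlonglongrightarrow> a"
proof -
  have "\<forall>\<^sub>F i in sequentially. (norm (x i - a))\<^sup>2 < e" if "0 < e" for e
  proof -
    from tails [of "e / 8"] \<open>0 < e\<close> obtain J1
      where J1: "finite J1" "\<forall>\<^sub>F i in sequentially. tail J1 (x i) \<le> e / 8" by auto
    \<comment> \<open>On \<open>- J\<close> the difference has mass at most \<open>2 * (e / 8) + 2 * (e / 8) = e / 2\<close>.\<close>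
    from tail_small [of "e / 8" a] \<open>0 < e\<close> obtain J2 where J2: "finite J2" "tail J2 a < e / 8" by auto
    define J where "J = J1 \<union> J2"
    have J: "finite J" using J1 J2 by (simp add: J_def)
    have "(\<lambda>i. \<Sum>j\<in>J. (cmod (coord (x i) j - coord a j))\<^sup>2) \<longlonglongrightarrow> (\<Sum>j\<in>J. (cmod (coord a j - coord a j))\<^sup>2)"
      by (intro tendsto_intros coord)
    then have "\<forall>\<^sub>F i in sequentially. (\<Sum>j\<in>J. (cmod (coord (x i) j - coord a j))\<^sup>2) < e / 2"
      by (rule order_tendstoD) (use \<open>0 < e\<close> in simp)
    with J1(2) show ?thesis
    proof eventually_elim
      case (elim i)
      have "(norm (x i - a))\<^sup>2 = (\<Sum>j\<in>J. (cmod (coord (x i) j - coord a j))\<^sup>2) + tail J (x i - a)"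
        using norm_split_tail [OF J, of "x i - a"] by simp
      moreover have "tail J (x i - a) \<le> 2 * tail J (x i) + 2 * tail J a"
        by (intro wsum_diff_le) (auto simp: indicator_def)
      moreover have "tail J (x i) \<le> tail J1 (x i)" "tail J a \<le> tail J2 a"
        by (rule tail_antimono, simp add: J_def)+
      ultimately show ?case using elim J2(2) by linarith
    qed
  qed
  then have "(\<lambda>i. (norm (x i - a))\<^sup>2) \<longlonglongrightarrow> 0"
    by (intro order_tendstoI) (auto intro!: always_eventually intro: less_le_trans)
  then have "(\<lambda>i. sqrt ((norm (x i - a))\<^sup>2)) \<longlonglongrightarrow> sqrt 0" by (rule tendsto_real_sqrt)
  then show ?thesis by (simp add: tendsto_norm_zero_iff LIM_zero_iff)
qed

text \<open>Fatou's lemma, which is what keeps a coordinatewise limit inside the space.\<close>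

lemma coordinatewise_limit_in_ell2:
  assumes coord: "\<And>j. (\<lambda>i. coord (x i) j) \<longlonglongrightarrow> a j" and bounded: "\<And>i. norm (x i) \<le> C"
  obtains b where "coord b = a"
proof
  have "(\<lambda>j. (cmod (a j))\<^sup>2) summable_on UNIV"
  proof (rule nonneg_bdd_above_summable_on)
    show "bdd_above (sum (\<lambda>j. (cmod (a j))\<^sup>2) ` {F. F \<subseteq> UNIV \<and> finite F})"
    proof (rule bdd_aboveI2)
      fix F :: "int set" assume "F \<in> {F. F \<subseteq> UNIV \<and> finite F}"
      then have F: "finite F" by simp
      have "(\<lambda>i. \<Sum>j\<in>F. (cmod (coord (x i) j))\<^sup>2) \<longlonglongrightarrow> (\<Sum>j\<in>F. (cmod (a j))\<^sup>2)"
        by (intro tendsto_intros coord)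
      moreover have "(\<Sum>j\<in>F. (cmod (coord (x i) j))\<^sup>2) \<le> C\<^sup>2" for i
      proof -
        have "(\<Sum>j\<in>F. (cmod (coord (x i) j))\<^sup>2) \<le> (norm (x i))\<^sup>2"
          using norm_split_tail [OF F, of "x i"] wsum_nonneg [of "indicat_real (- F)" "x i"] by simp
        also have "\<dots> \<le> C\<^sup>2" using bounded [of i] by (simp add: power_mono)
        finally show ?thesis .
      qed
      ultimately show "(\<Sum>j\<in>F. (cmod (a j))\<^sup>2) \<le> C\<^sup>2"
        by (intro LIMSEQ_le_const2) auto
    qed
  qed simp
  then show "coord (Abs_ell2 a) = a" by (rule coord_Abs_ell2)
qed

text \<open>
  A Cauchy sequence has uniformly small tails, because all late terms are close to one of them.
  Completeness is what the contraction argument for the implicit step rests on.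
\<close>
instance ell2 :: banach
proof
  fix x :: "nat \<Rightarrow> ell2" assume x: "Cauchy x"
  have "Cauchy (\<lambda>i. coord (x i) j)" for j
  proof (rule metric_CauchyI)
    fix e :: real assume "0 < e"
    with x obtain M where "\<forall>m\<ge>M. \<forall>n\<ge>M. dist (x m) (x n) < e" by (auto dest: metric_CauchyD)
    moreover have "dist (coord (x m) j) (coord (x n) j) \<le> dist (x m) (x n)" for m n
      using coord_le_norm [of "x m - x n" j] by (simp add: dist_norm)
    ultimately show "\<exists>M. \<forall>m\<ge>M. \<forall>n\<ge>M. dist (coord (x m) j) (coord (x n) j) < e"
      by (meson le_less_trans)
  qed
  then have "\<forall>j. \<exists>l. (\<lambda>i. coord (x i) j) \<longlonglongrightarrow> l" by (simp add: Cauchy_convergent_iff convergent_def)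
  then obtain a where a: "\<And>j. (\<lambda>i. coord (x i) j) \<longlonglongrightarrow> a j" by metis
  from cauchy_imp_bounded [OF x] obtain C where "\<And>i. norm (x i) \<le> C" by (auto simp: bounded_iff)
  with a obtain b where b: "coord b = a" by (rule coordinatewise_limit_in_ell2)
  have "x \<longlonglongrightarrow> b"
  proof (rule tendsto_ell2I)
    show "(\<lambda>i. coord (x i) j) \<longlonglongrightarrow> coord b j" for j using a b by simp
    fix e :: real assume e: "0 < e"
    then obtain M where M: "\<forall>m\<ge>M. \<forall>n\<ge>M. dist (x m) (x n) < sqrt (e / 4)"
      using x metric_CauchyD [of x "sqrt (e / 4)"] by auto
    obtain J where J: "finite J" "tail J (x M) < e / 4" using tail_small [of "e / 4"] e by auto
    have "tail J (x i) \<le> e" if "i \<ge> M" for i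
    proof -
      have "tail J (x M - (x M - x i)) \<le> 2 * tail J (x M) + 2 * tail J (x M - x i)"
        by (intro wsum_diff_le) (auto simp: indicator_def)
      moreover have "tail J (x M - x i) \<le> (norm (x M - x i))\<^sup>2"
        by (intro wsum_le_norm) (auto simp: indicator_def)
      moreover have "(norm (x M - x i))\<^sup>2 \<le> (sqrt (e / 4))\<^sup>2"
        using M that by (intro power_mono) (auto simp: dist_norm less_imp_le)
      ultimately show ?thesis using J e by simp
    qed
    with J(1) show "\<exists>J. finite J \<and> (\<forall>\<^sub>F i in sequentially. tail J (x i) \<le> e)"
      by (auto intro!: exI [of _ J] eventually_sequentiallyI)
  qed
  then show "convergent x" by (auto simp: convergent_def)
qed

text \<open>
  Tychonoff's theorem gives a coordinatewise convergent subsequence, and the uniform smallness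
  of the tails upgrades the convergence.
\<close>

lemma ell2_convergent_subseq:
  assumes bounded: "\<And>i. norm (x i) \<le> C"
    and tails: "\<And>e. 0 < e \<Longrightarrow> \<exists>J. finite J \<and> (\<forall>\<^sub>F i in sequentially. tail J (x i) \<le> e)"
  obtains a s where "strict_mono s" "(\<lambda>i. x (s i)) \<longlonglongrightarrow> a"
proof -
  let ?K = "PiE UNIV (\<lambda>_. cball (0::complex) C) :: (int \<Rightarrow> complex) set"
  have "compactin (product_topology (\<lambda>_::int. euclidean :: complex topology) UNIV) ?K"
    by (simp add: compactin_PiE)
  then have "compact ?K" by (simp add: euclidean_product_topology)
  then have "seq_compact ?K" by (rule compact_imp_seq_compact)
  moreover have "coord (x i) \<in> ?K" for i
    using order_trans [OF coord_le_norm bounded] by auto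
  ultimately obtain l s where s: "strict_mono s" and l: "((\<lambda>i. coord (x i)) \<circ> s) \<longlonglongrightarrow> l"
    by (metis seq_compactE)
  have l': "(\<lambda>i. coord (x (s i)) j) \<longlonglongrightarrow> l j" for j
    using continuous_on_tendsto_compose [OF continuous_on_product_coordinates [of j] l]
    by (simp add: o_def)
  then obtain a where a: "coord a = l"
    by (rule coordinatewise_limit_in_ell2 [OF _ bounded])
  have "(\<lambda>i. x (s i)) \<longlonglongrightarrow> a"
  proof (rule tendsto_ell2I)
    show "(\<lambda>i. coord (x (s i)) j) \<longlonglongrightarrow> coord a j" for j using l' a by simp
    show "\<exists>J. finite J \<and> (\<forall>\<^sub>F i in sequentially. tail J (x (s i)) \<le> e)" if "0 < e" for e
      using tails [OF that] eventually_subseq [OF s] by blast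
  qed
  with s that show ?thesis by blast
qed

text \<open>
  No mass can escape to infinity when the norms stay below the norm of the limit: the finite part
  already accounts for nearly all of it.
\<close>

lemma tendsto_ell2_norm_le:
  assumes coord: "\<And>j. (\<lambda>i. coord (x i) j) \<longlonglongrightarrow> coord a j" and norm: "\<And>i. norm (x i) \<le> norm a"
  shows "x \<longlonglongrightarrow> a"
proof (rule tendsto_ell2I [OF coord])
  fix e :: real assume e: "0 < e"
  from tail_small [of "e / 2" a] e obtain J where J: "finite J" "tail J a < e / 2" by auto
  have "(\<lambda>i. \<Sum>j\<in>J. (cmod (coord (x i) j))\<^sup>2) \<longlonglongrightarrow> (\<Sum>j\<in>J. (cmod (coord a j))\<^sup>2)"
    by (intro tendsto_intros coord)
  then have "\<forall>\<^sub>F i in sequentially. (\<Sum>j\<in>J. (cmod (coord (x i) j))\<^sup>2) > (\<Sum>j\<in>J. (cmod (coord a j))\<^sup>2) - e / 2"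
    by (rule order_tendstoD) (use e in simp)
  then have "\<forall>\<^sub>F i in sequentially. tail J (x i) \<le> e"
  proof eventually_elim
    case (elim i)
    have "(norm (x i))\<^sup>2 \<le> (norm a)\<^sup>2" by (simp add: norm power_mono)
    with elim J norm_split_tail [OF J(1), of "x i"] norm_split_tail [OF J(1), of a] show ?case by linarith
  qed
  with J(1) show "\<exists>J. finite J \<and> (\<forall>\<^sub>F i in sequentially. tail J (x i) \<le> e)" by blast
qed


section \<open>Limit sets of perturbed iterations\<close>

text \<open>
  Suppose that points \<open>z i\<close> of the limit sets of infinitely many \<open>S (r i)\<close> stay away from the limit set
  of \<open>T\<close>. Each is nearly reached by an orbit of \<open>S (r i)\<close> of length \<open>n i > i\<close>. By asymptotic compactness the
  endpoints of these orbits, and also the points \<open>N\<close> steps before the end, accumulate; convergence of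
  the maps says that \<open>T ^^ N\<close> takes the second accumulation point to the first. Hence an
  accumulation point of the \<open>z i\<close> lies in the image of \<open>T ^^ N\<close> for every \<open>N\<close>, so in the limit set of \<open>T\<close>.
\<close>
lemma limit_set_semicontinuous:
  fixes S :: "nat \<Rightarrow> 'a::metric_space \<Rightarrow> 'a" and T :: "'a \<Rightarrow> 'a"
  assumes B: "closed B" "\<And>m. D m \<subseteq> B" and S: "\<And>m x. x \<in> D m \<Longrightarrow> S m x \<in> D m"
    and T: "\<And>x. x \<in> B \<Longrightarrow> T x \<in> B"
    and conv: "\<And>r x w. strict_mono r \<Longrightarrow> (\<And>i. x i \<in> D (r i)) \<Longrightarrow> x \<longlonglongrightarrow> w \<Longrightarrow>
      (\<lambda>i. S (r i) (x i)) \<longlonglongrightarrow> T w"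
    and compact: "\<And>r n y. strict_mono r \<Longrightarrow> filterlim n at_top sequentially \<Longrightarrow>
      (\<And>i. y i \<in> D (r i)) \<Longrightarrow>
      \<exists>s w. strict_mono (s :: nat \<Rightarrow> nat) \<and> (\<lambda>i. (S (r (s i)) ^^ n (s i)) (y (s i))) \<longlonglongrightarrow> w"
    and e: "0 < e"
  shows "\<forall>\<^sub>F m in sequentially. \<forall>z\<in>attractor_of euclidean (\<lambda>n. S m ^^ n) (D m).
           \<exists>b\<in>attractor_of euclidean (\<lambda>n. T ^^ n) B. dist z b < e"
proof (rule ccontr)
  let ?A = "\<lambda>m. attractor_of euclidean (\<lambda>n. S m ^^ n) (D m)"
  let ?A' = "attractor_of euclidean (\<lambda>n. T ^^ n) B"
  have S_pow: "(S m ^^ n) x \<in> D m" if "x \<in> D m" for m n x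
    by (induction n) (use that S in auto)
  have T_pow: "(T ^^ n) x \<in> B" if "x \<in> B" for n x
    by (induction n) (use that T in auto)
  have conv_pow: "(\<lambda>i. (S (r i) ^^ n) (x i)) \<longlonglongrightarrow> (T ^^ n) w"
    if "strict_mono r" "\<And>i. x i \<in> D (r i)" "x \<longlonglongrightarrow> w" for r x w n
  proof (induction n)
    case (Suc n)
    show ?case using conv [OF that(1) _ Suc.IH] S_pow that(2) by simp
  qed (use that in simp)
  assume "\<not> (\<forall>\<^sub>F m in sequentially. \<forall>z\<in>?A m. \<exists>b\<in>?A'. dist z b < e)"
  then have "\<exists>\<^sub>F m in sequentially. \<exists>z\<in>?A m. \<forall>b\<in>?A'. e \<le> dist z b"
    by (simp add: not_eventually not_less)
  then have "infinite {m. \<exists>z\<in>?A m. \<forall>b\<in>?A'. e \<le> dist z b}"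
    by (simp add: frequently_cofinite flip: cofinite_eq_sequentially)
  from infinite_enumerate [OF this] obtain r :: "nat \<Rightarrow> nat" where r: "strict_mono r"
    and "\<forall>i. r i \<in> {m. \<exists>z\<in>?A m. \<forall>b\<in>?A'. e \<le> dist z b}"
    by blast
  from this(2) have "\<forall>i. \<exists>z\<in>?A (r i). \<forall>b\<in>?A'. e \<le> dist z b" by simp
  then obtain z where z: "\<And>i. z i \<in> ?A (r i)" and far: "\<And>i b. b \<in> ?A' \<Longrightarrow> e \<le> dist (z i) b"
    by metis
  have "\<exists>n y. n \<ge> Suc i \<and> y \<in> D (r i) \<and> dist ((S (r i) ^^ n) y) (z i) < 1 / (Suc i)" for i
  proof -
    have "z i \<in> closure (\<Union>n\<in>{Suc i..}. (S (r i) ^^ n) ` D (r i))"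
      using z [of i] by (auto simp: attractor_of_def)
    then have "\<exists>x\<in>(\<Union>n\<in>{Suc i..}. (S (r i) ^^ n) ` D (r i)). dist x (z i) < 1 / Suc i"
      by (rule closure_approachable [THEN iffD1, rule_format]) simp
    then show ?thesis by auto
  qed
  then obtain n y where n: "\<And>i. n i \<ge> Suc i" and y: "\<And>i. y i \<in> D (r i)"
    and close: "\<And>i. dist ((S (r i) ^^ n i) (y i)) (z i) < 1 / (Suc i)"
    by metis
  have n_lim: "filterlim (\<lambda>i. n i - N) at_top sequentially" for N
  proof (rule filterlim_at_top_mono)
    show "filterlim (\<lambda>i. i - N) at_top sequentially" by (rule filterlim_minus_const_nat_at_top)
    show "\<forall>\<^sub>F i in sequentially. i - N \<le> n i - N"
      using n by (intro always_eventually allI diff_le_mono) (auto dest: Suc_leD)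
  qed
  obtain s w where s: "strict_mono s" and w: "(\<lambda>i. (S (r (s i)) ^^ n (s i)) (y (s i))) \<longlonglongrightarrow> w"
    using compact [OF r n_lim [of 0] y] by auto
  \<comment> \<open>Going back \<open>N\<close> steps along the approximating orbits yields a preimage of \<open>w\<close> under \<open>T ^^ N\<close>.\<close>
  have "\<exists>v\<in>B. (T ^^ N) v = w" for N
  proof -
    have "filterlim (\<lambda>i. n (s i) - N) at_top sequentially"
      using filterlim_compose [OF n_lim filterlim_subseq [OF s]] by simp
    from compact [OF strict_mono_o [OF r s] this, of "y \<circ> s"] y
    obtain t v where t: "strict_mono t"
      and v: "(\<lambda>i. (S (r (s (t i))) ^^ (n (s (t i)) - N)) (y (s (t i)))) \<longlonglongrightarrow> v" (is "?x \<longlonglongrightarrow> v")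
      by auto
    have x: "?x i \<in> D (r (s (t i)))" for i by (rule S_pow [OF y])
    then have "v \<in> B"
      by (intro closed_sequentially [OF B(1) _ v]) (use B(2) in blast)
    have rst: "strict_mono (\<lambda>i. r (s (t i)))"
      using strict_mono_o [OF r strict_mono_o [OF s t]] by (simp add: o_def)
    have "(\<lambda>i. (S (r (s (t i))) ^^ N) (?x i)) \<longlonglongrightarrow> (T ^^ N) v"
      using x by (intro conv_pow [OF rst _ v]) simp
    moreover have "\<forall>\<^sub>F i in sequentially. (S (r (s (t i))) ^^ N) (?x i)
        = (S (r (s (t i))) ^^ n (s (t i))) (y (s (t i)))"
    proof (rule eventually_sequentiallyI)
      fix i assume "N \<le> i"
      also have "i \<le> t i" by (rule seq_suble [OF t])
      also have "t i \<le> s (t i)" by (rule seq_suble [OF s])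
      also have "\<dots> \<le> n (s (t i))" using n Suc_leD by blast
      finally have "N + (n (s (t i)) - N) = n (s (t i))" by simp
      then show "(S (r (s (t i))) ^^ N) (?x i) = (S (r (s (t i))) ^^ n (s (t i))) (y (s (t i)))"
        by (metis comp_apply funpow_add)
    qed
    ultimately have "(\<lambda>i. (S (r (s (t i))) ^^ n (s (t i))) (y (s (t i)))) \<longlonglongrightarrow> (T ^^ N) v"
      using tendsto_cong by fast
    moreover have "(\<lambda>i. (S (r (s (t i))) ^^ n (s (t i))) (y (s (t i)))) \<longlonglongrightarrow> w"
      using LIMSEQ_subseq_LIMSEQ [OF w t] by (simp add: o_def)
    ultimately show ?thesis using \<open>v \<in> B\<close> LIMSEQ_unique by blast
  qed
  then have "w \<in> closure (\<Union>n\<in>{N..}. (T ^^ n) ` B)" for N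
    by (intro subsetD [OF closure_subset]) force
  then have "w \<in> ?A'" by (simp add: attractor_of_def)
  have "(\<lambda>i. dist ((S (r (s i)) ^^ n (s i)) (y (s i))) (z (s i))) \<longlonglongrightarrow> 0"
  proof (rule tendsto_sandwich [where f = "\<lambda>_. 0" and h = "\<lambda>i. 1 / real (Suc i)"])
    show "(\<lambda>i. 1 / real (Suc i)) \<longlonglongrightarrow> 0" by (rule LIMSEQ_Suc [OF lim_1_over_n])
    have "dist ((S (r (s i)) ^^ n (s i)) (y (s i))) (z (s i)) \<le> 1 / real (Suc i)" for i
    proof -
      have "1 / real (Suc (s i)) \<le> 1 / real (Suc i)"
        using seq_suble [OF s, of i] by (intro divide_left_mono) auto
      with close [of "s i"] show ?thesis by linarith
    qed
    then show "\<forall>\<^sub>F i in sequentially. dist ((S (r (s i)) ^^ n (s i)) (y (s i))) (z (s i)) \<le> 1 / real (Suc i)"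
      by simp
  qed simp_all
  from tendsto_add [OF this w [THEN iffD1 [OF tendsto_dist_iff]]]
  have "\<forall>\<^sub>F i in sequentially. dist ((S (r (s i)) ^^ n (s i)) (y (s i))) (z (s i))
      + dist ((S (r (s i)) ^^ n (s i)) (y (s i))) w < e"
    by (rule order_tendstoD) (use e in simp)
  then obtain i where "dist ((S (r (s i)) ^^ n (s i)) (y (s i))) (z (s i))
      + dist ((S (r (s i)) ^^ n (s i)) (y (s i))) w < e"
    by (auto simp: eventually_sequentially)
  then have "dist (z (s i)) w < e"
    by (rule le_less_trans [OF dist_triangle3, rotated])
  with far [OF \<open>w \<in> ?A'\<close>, of "s i"] show False by simp
qed


section \<open>Solving the implicit equation by contraction\<close>

text \<open>
  The map \<open>u \<mapsto> y + eps *\<^sub>R F u\<close> is a contraction of the ball of radius \<open>r + 1\<close>; the room of \<open>1\<close> pays for the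
  increment \<open>eps * M\<close>.
\<close>
lemma ex1_implicit_step:
  fixes F :: "'a::banach \<Rightarrow> 'a"
  assumes r: "0 \<le> r" and eps: "0 < eps"
    and M: "\<And>u. u \<in> cball 0 (r + 1) \<Longrightarrow> norm (F u) \<le> M" "eps * M \<le> 1"
    and L: "\<And>u v. u \<in> cball 0 (r + 1) \<Longrightarrow> v \<in> cball 0 (r + 1) \<Longrightarrow> norm (F u - F v) \<le> L * norm (u - v)"
      "0 \<le> L" "eps * L < 1"
    and y: "y \<in> cball 0 r"
  shows "\<exists>!u. u \<in> cball 0 (r + 1) \<and> u = y + eps *\<^sub>R F u"
proof -
  have "\<exists>!u\<in>cball 0 (r + 1). y + eps *\<^sub>R F u = u"
  proof (rule Banach_fix)
    show "complete (cball (0::'a) (r + 1))" by (simp add: complete_eq_closed)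
    show "(\<lambda>u. y + eps *\<^sub>R F u) ` cball 0 (r + 1) \<subseteq> cball 0 (r + 1)"
    proof safe
      fix u :: 'a assume "u \<in> cball 0 (r + 1)"
      then have "eps * norm (F u) \<le> 1"
        using M(1) [of u] M(2) eps mult_left_mono [of "norm (F u)" M eps] by linarith
      then have "norm (y + eps *\<^sub>R F u) \<le> r + 1"
        using y eps by (intro order_trans [OF norm_triangle_ineq]) auto
      then show "y + eps *\<^sub>R F u \<in> cball 0 (r + 1)" by simp
    qed
    show "dist (y + eps *\<^sub>R F u) (y + eps *\<^sub>R F v) \<le> (eps * L) * dist u v"
      if "u \<in> cball 0 (r + 1)" "v \<in> cball 0 (r + 1)" for u v
      using mult_left_mono [OF L(1) [OF that], of eps] eps
      by (simp add: dist_norm mult.assoc flip: scaleR_diff_right)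
  qed (use r eps L in auto)
  then show ?thesis by (metis (no_types))
qed

section \<open>Difference operators along a permutation of the sites\<close>

text \<open>
  The Laplacian of the infinite lattice and the periodic one are the same expression in a
  bijection of the sites: the shift, respectively a cyclic permutation of the window. All
  estimates are proved once, for an arbitrary bijection.
\<close>
definition permute :: "(int \<Rightarrow> int) \<Rightarrow> ell2 \<Rightarrow> ell2"
  where "permute \<sigma> u = Abs_ell2 (\<lambda>j. coord u (\<sigma> j))"

definition plap :: "(int \<Rightarrow> int) \<Rightarrow> ell2 \<Rightarrow> ell2"
  where "plap \<sigma> u = 2 *\<^sub>R u - permute \<sigma> u - permute (inv \<sigma>) u"

lemma coord_permute [simp]: "bij \<sigma> \<Longrightarrow> coord (permute \<sigma> u) j = coord u (\<sigma> j)"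
  using summable_on_reindex_bij_betw [of \<sigma> UNIV UNIV "\<lambda>j. (cmod (coord u j))\<^sup>2"] coord_summable [of u]
  by (simp add: permute_def coord_Abs_ell2)

lemma norm_permute: "bij \<sigma> \<Longrightarrow> norm (permute \<sigma> u) = norm u"
  using infsum_reindex_bij_betw [of \<sigma> UNIV UNIV "\<lambda>j. (cmod (coord u j))\<^sup>2"]
  by (simp add: norm_ell2_def)

lemma coord_plap:
  "bij \<sigma> \<Longrightarrow> coord (plap \<sigma> u) j = 2 * coord u j - coord u (\<sigma> j) - coord u (inv \<sigma> j)"
  by (simp add: plap_def bij_imp_bij_inv)

lemma norm_plap_le: "bij \<sigma> \<Longrightarrow> norm (plap \<sigma> u) \<le> 4 * norm u"
  using norm_triangle_ineq4 [of "2 *\<^sub>R u - permute \<sigma> u" "permute (inv \<sigma>) u"]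
    norm_triangle_ineq4 [of "2 *\<^sub>R u" "permute \<sigma> u"]
  by (simp add: plap_def norm_permute bij_imp_bij_inv)

lemma plap_diff: "bij \<sigma> \<Longrightarrow> plap \<sigma> (u - v) = plap \<sigma> u - plap \<sigma> v"
  by (rule ell2_eqI) (simp add: coord_plap)

lemma inv_shift: "inv (\<lambda>j::int. j + 1) = (\<lambda>j. j - 1)"
  by (rule inv_equality) auto

lemma bij_shift: "bij (\<lambda>j::int. j + 1)"
  by (rule bij_betw_byWitness [of _ "\<lambda>j. j - 1"]) auto

lemma Lap_eq_plap: "Lap = plap (\<lambda>j. j + 1)"
  by (intro ext ell2_eqI) (simp add: coord_plap bij_shift inv_shift Lap.rep_eq)

text \<open>
  Sites outside of the window are fixed, so that the associated Laplacian vanishes there and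
  sequences supported in the window form an invariant subspace.
\<close>
definition cyclic_shift :: "nat \<Rightarrow> int \<Rightarrow> int"
  where "cyclic_shift m j = (if j \<in> idx m then if j = int m then - int m else j + 1 else j)"

lemma inv_cyclic_shift:
  "inv (cyclic_shift m) = (\<lambda>j. if j \<in> idx m then if j = - int m then int m else j - 1 else j)"
  by (rule inv_equality) (auto simp: cyclic_shift_def idx_def)

lemma bij_cyclic_shift: "bij (cyclic_shift m)"
  by (rule bij_betw_byWitness
      [of _ "\<lambda>j. if j \<in> idx m then if j = - int m then int m else j - 1 else j"])
    (auto simp: cyclic_shift_def idx_def)

text \<open>
  Permuting the sites preserves the norm, so coordinatewise convergence suffices.
\<close>
lemma permute_tendsto:
  assumes "\<And>m. bij (\<sigma> m)" "bij \<tau>" "\<And>j. \<forall>\<^sub>F m in sequentially. \<sigma> m j = \<tau> j"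
  shows "(\<lambda>m. permute (\<sigma> m) u) \<longlonglongrightarrow> permute \<tau> u"
proof (rule tendsto_ell2_norm_le)
  show "(\<lambda>m. coord (permute (\<sigma> m) u) j) \<longlonglongrightarrow> coord (permute \<tau> u) j" for j
    by (intro tendsto_eventually eventually_mono [OF assms(3) [of j]]) (simp add: assms)
qed (simp add: norm_permute assms)

lemma plap_cyclic_tendsto: "(\<lambda>m. plap (cyclic_shift m) u) \<longlonglongrightarrow> Lap u"
  unfolding Lap_eq_plap plap_def
proof (intro tendsto_diff tendsto_const permute_tendsto bij_imp_bij_inv bij_cyclic_shift bij_shift)
  show "\<forall>\<^sub>F m in sequentially. cyclic_shift m j = j + 1" for j
    by (rule eventually_sequentiallyI [of "nat (\<bar>j\<bar> + 1)"]) (auto simp: cyclic_shift_def idx_def)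
  show "\<forall>\<^sub>F m in sequentially. inv (cyclic_shift m) j = inv (\<lambda>j. j + 1) j" for j
    by (rule eventually_sequentiallyI [of "nat (\<bar>j\<bar> + 1)"])
      (auto simp: inv_cyclic_shift inv_shift idx_def)
qed


section \<open>The weighted energy estimate\<close>

text \<open>
  Young's inequality with the exponents \<open>p + 2\<close> and \<open>(p + 2) / (p + 1)\<close>, scaled so that the power of \<open>x\<close>
  appears with exactly the coefficient \<open>k\<close> of the damping term.
\<close>
lemma Young_powr:
  fixes x y k p :: real
  assumes "0 \<le> x" "0 \<le> y" "0 < k" "0 < p"
  shows "x * y \<le> k * x powr (p + 2)
    + (p + 1) / (p + 2) * (1 / (k * (p + 2)) powr (1 / (p + 1))) * y powr ((p + 2) / (p + 1))"
proof -
  define c where "c = (k * (p + 2)) powr (1 / (p + 2))"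
  have c: "c > 0" using assms by (simp add: c_def)
  have "c * x * (y / c) \<le> (c * x) powr (p + 2) / (p + 2) + (y / c) powr ((p + 2) / (p + 1)) / ((p + 2) / (p + 1))"
    using assms c by (intro Youngs_inequality) (auto simp: field_simps)
  moreover have "c * x * (y / c) = x * y" using c by simp
  moreover have "(c * x) powr (p + 2) / (p + 2) = k * x powr (p + 2)"
    using assms c by (simp add: powr_mult c_def powr_powr)
  moreover have "(y / c) powr ((p + 2) / (p + 1)) / ((p + 2) / (p + 1))
      = (p + 1) / (p + 2) * (1 / (k * (p + 2)) powr (1 / (p + 1))) * y powr ((p + 2) / (p + 1))"
  proof -
    have "1 / (p + 2) * ((p + 2) / (p + 1)) = 1 / (p + 1)" using assms by simp
    then have "c powr ((p + 2) / (p + 1)) = (k * (p + 2)) powr (1 / (p + 1))"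
      by (simp add: c_def powr_powr)
    then show ?thesis using assms c by (simp add: powr_divide mult.commute)
  qed
  ultimately show ?thesis by simp
qed

lemma inner_le_half_squares: "inner (a::complex) b \<le> ((cmod a)\<^sup>2 + (cmod b)\<^sup>2) / 2"
proof -
  have "inner a b \<le> cmod a * cmod b" by (rule norm_cauchy_schwarz)
  also have "\<dots> \<le> ((cmod a)\<^sup>2 + (cmod b)\<^sup>2) / 2"
    using sum_squares_bound [of "cmod a" "cmod b"] by simp
  finally show ?thesis .
qed

lemma inner_mult_self: "inner (z * a) a = Re z * (cmod a)\<^sup>2" for z a :: complex
  unfolding cmod_power2 inner_complex_def by (simp add: power2_eq_square algebra_simps)

text \<open>
  The share of one edge, joining sites with values \<open>a\<close>, \<open>b\<close> and weights \<open>t\<close>, \<open>s\<close>, in the pairing of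
  \<open>c\<close> times the Laplacian of \<open>u\<close> with the weighted \<open>u\<close>. When \<open>s = t\<close> the two cross terms add up to
  \<open>2 * Re c * t * inner a b\<close>: the imaginary part of \<open>c\<close> disappears, as it must for a self-adjoint
  operator. Otherwise an error proportional to the difference of the weights remains.
\<close>
lemma weighted_edge_bound:
  fixes a b c :: complex and s t d :: real
  assumes c: "0 \<le> Re c" and t: "0 \<le> t" and d: "\<bar>t - s\<bar> \<le> d"
  shows "2 * Re c * (t * (cmod a)\<^sup>2) - t * inner (c * b) a - s * inner (c * a) b
    \<le> Re c * (3 * (t * (cmod a)\<^sup>2) + s * (cmod b)\<^sup>2) + 2 * (d * cmod c) * ((cmod a)\<^sup>2 + (cmod b)\<^sup>2)"
proof -
  \<comment> \<open>The imaginary part of \<open>c\<close> contributes an antisymmetric form.\<close>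
  have skew: "inner (c * b) a + inner (c * a) b = 2 * Re c * inner a b"
    by (simp add: inner_complex_def algebra_simps)
  have "(t - s) * inner (c * a) b \<le> d * (cmod c * cmod a * cmod b)"
  proof -
    have "\<bar>inner (c * a) b\<bar> \<le> cmod c * cmod a * cmod b"
      using Cauchy_Schwarz_ineq2 [of "c * a" b] by (simp add: norm_mult)
    then have "\<bar>t - s\<bar> * \<bar>inner (c * a) b\<bar> \<le> d * (cmod c * cmod a * cmod b)"
      using d by (intro mult_mono) auto
    moreover have "(t - s) * inner (c * a) b \<le> \<bar>t - s\<bar> * \<bar>inner (c * a) b\<bar>"
      by (metis abs_ge_self abs_mult)
    ultimately show ?thesis by linarith
  qed
  moreover have "d * (cmod c * cmod a * cmod b) \<le> (d * cmod c) * ((cmod a)\<^sup>2 + (cmod b)\<^sup>2)"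
  proof -
    have "cmod a * cmod b \<le> (cmod a)\<^sup>2 + (cmod b)\<^sup>2"
    proof -
      have "0 \<le> cmod a * cmod b" by simp
      with sum_squares_bound [of "cmod a" "cmod b"] show ?thesis by linarith
    qed
    moreover have "0 \<le> d * cmod c" using d by (intro mult_nonneg_nonneg) auto
    ultimately have "(d * cmod c) * (cmod a * cmod b) \<le> (d * cmod c) * ((cmod a)\<^sup>2 + (cmod b)\<^sup>2)"
      by (rule mult_left_mono)
    then show ?thesis by (simp only: mult.assoc)
  qed
  moreover have "2 * Re c * t * (- inner a b) \<le> Re c * t * (cmod a)\<^sup>2 + Re c * t * (cmod b)\<^sup>2"
  proof -
    have "- inner a b \<le> ((cmod a)\<^sup>2 + (cmod b)\<^sup>2) / 2"
      using inner_le_half_squares [of "- a" b] by simp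
    from mult_left_mono [OF this, of "2 * Re c * t"] c t show ?thesis by (simp add: algebra_simps)
  qed
  moreover have "Re c * t * (cmod b)\<^sup>2 \<le> Re c * s * (cmod b)\<^sup>2 + (d * cmod c) * (cmod b)\<^sup>2"
  proof -
    have "Re c * (t - s) \<le> cmod c * d"
    proof -
      have "Re c * (t - s) \<le> Re c * d" using c d by (intro mult_left_mono) auto
      also have "\<dots> \<le> cmod c * d" using c d abs_Re_le_cmod [of c] by (intro mult_right_mono) auto
      finally show ?thesis .
    qed
    from mult_right_mono [OF this, of "(cmod b)\<^sup>2"] show ?thesis by (simp add: algebra_simps)
  qed
  moreover have "0 \<le> (d * cmod c) * (cmod a)\<^sup>2" using d by (intro mult_nonneg_nonneg) auto
  moreover have "2 * Re c * (t * (cmod a)\<^sup>2) - t * inner (c * b) a - s * inner (c * a) b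
      = 2 * Re c * t * (cmod a)\<^sup>2 + 2 * Re c * t * (- inner a b) + (t - s) * inner (c * a) b"
  proof -
    have "inner (c * b) a = 2 * Re c * inner a b - inner (c * a) b" using skew by linarith
    then show ?thesis by (simp only:) (simp add: algebra_simps)
  qed
  ultimately show ?thesis by (simp add: algebra_simps)
qed

lemma weighted_inner_summable:
  assumes "\<And>j. 0 \<le> \<theta> j" "\<And>j. \<theta> j \<le> (1::real)"
  shows "(\<lambda>j. \<theta> j * inner (coord u j) (coord v j)) summable_on UNIV"
proof -
  have "(\<lambda>j. norm (\<theta> j * inner (coord u j) (coord v j))) summable_on UNIV"
  proof (rule Infinite_Sum.abs_summable_on_comparison_test')
    show "(\<lambda>j. norm (inner (coord u j) (coord v j))) summable_on UNIV"
      using inner_summable [of u v] by (rule summable_on_iff_abs_summable_on_real [THEN iffD1])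
    show "norm (\<theta> j * inner (coord u j) (coord v j)) \<le> norm (inner (coord u j) (coord v j))" for j
      using assms [of j] by (simp add: abs_mult mult_left_le_one_le)
  qed
  then show ?thesis by (rule abs_summable_summable)
qed

locale lattice_system =
  fixes lam \<mu> \<gamma> \<beta> k \<nu> p :: real
  assumes params: "lam > 0" "k > 0" "p > 0" "\<gamma> > 4 * lam"
begin

definition pfield :: "(int \<Rightarrow> int) \<Rightarrow> ell2 \<Rightarrow> ell2 \<Rightarrow> ell2"
  where "pfield \<sigma> h u =
    Complex lam \<mu> *\<^sub>C plap \<sigma> u - Complex \<gamma> \<beta> *\<^sub>C u - Complex k \<nu> *\<^sub>C nonlin p u + h"

lemma field_eq_pfield: "field lam \<mu> \<gamma> \<beta> k \<nu> p h = pfield (\<lambda>j. j + 1) h"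
  by (simp add: fun_eq_iff field_def pfield_def Lap_eq_plap)

lemma coord_pfield:
  "bij \<sigma> \<Longrightarrow> coord (pfield \<sigma> h u) j =
    Complex lam \<mu> * (2 * coord u j - coord u (\<sigma> j) - coord u (inv \<sigma> j)) - Complex \<gamma> \<beta> * coord u j
    - Complex k \<nu> * (complex_of_real (cmod (coord u j) powr p) * coord u j) + coord h j"
  using params by (simp add: pfield_def coord_plap coord_nonlin)

text \<open>
  The coefficient of the sum over \<open>g\<close> in \<^const>\<open>c1_const\<close>.
\<close>
definition young_const :: real
  where "young_const = (p + 1) / (p + 2) * (1 / (k * (p + 2)) powr (1 / (p + 1)))"

lemma young_const_nonneg: "0 \<le> young_const"
  using params by (simp add: young_const_def)

text \<open>
  Pair the implicit Euler equation with \<open>\<theta> j * coord u j\<close> and sum over the sites. The Laplacian costs at most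
  \<open>4 * lam\<close> times the weighted mass, up to the variation of \<open>\<theta>\<close> along \<open>\<sigma>\<close>; the linear damping \<open>\<gamma>\<close> beats
  this; the nonlinear damping absorbs the forcing by Young's inequality. Three weights matter:
  \<open>1\<close> shows that a ball is invariant, the indicator of the complement of a \<open>\<sigma>\<close>-invariant set shows that supports are
  preserved, and a slowly varying cutoff bounds the tails.
\<close>
lemma weighted_energy_estimate:
  fixes \<theta> :: "int \<Rightarrow> real" and q :: real
  defines "q \<equiv> (p + 2) / (p + 1)"
  assumes \<sigma>: "bij \<sigma>" and \<theta>: "\<And>j. 0 \<le> \<theta> j" "\<And>j. \<theta> j \<le> 1" and d: "\<And>j. \<bar>\<theta> j - \<theta> (\<sigma> j)\<bar> \<le> d"
    and eps: "0 < eps" and u: "u = y + eps *\<^sub>R pfield \<sigma> h u"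
    and h: "((\<lambda>j. \<theta> j * cmod (coord h j) powr q) has_sum H) UNIV"
  shows "(1 + 2 * eps * (\<gamma> - 4 * lam)) * wsum \<theta> u
    \<le> wsum \<theta> y + 2 * eps * (young_const * H + 4 * (d * cmod (Complex lam \<mu>)) * (norm u)\<^sup>2)"
proof -
  define c where "c = Complex lam \<mu>"
  define f where "f = (\<lambda>j. \<theta> j * inner (c * coord u (inv \<sigma> j)) (coord u j))"
  have c: "Re c = lam" by (simp add: c_def)
  \<comment> \<open>The term coming from the neighbour \<open>inv \<sigma> j\<close> is moved to the edge from \<open>j\<close> to \<open>\<sigma> j\<close> by reindexing: \<open>f\<close> and \<open>f \<circ> \<sigma>\<close> have the same sum, so adding \<open>f (\<sigma> j) + - f j\<close> to the bound at each site changes nothing in total.\<close>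
  have "f summable_on UNIV"
    using weighted_inner_summable [OF \<theta>, where u = "c *\<^sub>C permute (inv \<sigma>) u" and v = u]
    by (simp add: f_def \<sigma> bij_imp_bij_inv)
  then obtain X where X: "(f has_sum X) UNIV" by (auto simp: summable_on_def)
  then have X': "((\<lambda>j. f (\<sigma> j)) has_sum X) UNIV"
    using has_sum_reindex_bij_betw [OF \<sigma>] by blast
  have W: "((\<lambda>j. \<theta> j * (cmod (coord u j))\<^sup>2) has_sum wsum \<theta> u) UNIV"
    "((\<lambda>j. \<theta> j * (cmod (coord y j))\<^sup>2) has_sum wsum \<theta> y) UNIV"
    by (intro wsum_has_sum \<theta>)+
  then have W': "((\<lambda>j. \<theta> (\<sigma> j) * (cmod (coord u (\<sigma> j)))\<^sup>2) has_sum wsum \<theta> u) UNIV"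
    using has_sum_reindex_bij_betw [OF \<sigma>, of "\<lambda>j. \<theta> j * (cmod (coord u j))\<^sup>2"] by blast
  have N: "((\<lambda>j. (cmod (coord u (\<sigma> j)))\<^sup>2) has_sum (norm u)\<^sup>2) UNIV"
    using has_sum_reindex_bij_betw [OF \<sigma>, of "\<lambda>j. (cmod (coord u j))\<^sup>2"] norm_ell2_has_sum by blast
  have pointwise: "\<theta> j * (cmod (coord u j))\<^sup>2
    \<le> (\<theta> j * (cmod (coord u j))\<^sup>2 + \<theta> j * (cmod (coord y j))\<^sup>2) * (1 / 2)
      + eps * ((3 * lam - \<gamma>) * (\<theta> j * (cmod (coord u j))\<^sup>2) + lam * (\<theta> (\<sigma> j) * (cmod (coord u (\<sigma> j)))\<^sup>2)
        + (f (\<sigma> j) + - f j) + 2 * (d * cmod c) * ((cmod (coord u j))\<^sup>2 + (cmod (coord u (\<sigma> j)))\<^sup>2)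
        + young_const * (\<theta> j * cmod (coord h j) powr q))" for j
  proof -
    define a b b' w where "a = coord u j" and "b = coord u (\<sigma> j)" and "b' = coord u (inv \<sigma> j)"
      and "w = cmod a powr p"
    have "coord u j = coord y j + complex_of_real eps * coord (pfield \<sigma> h u) j"
      using arg_cong [OF u, of "\<lambda>v. coord v j"] by simp
    then have a: "a = coord y j + eps *\<^sub>R (c * (2 * a - b - b') - Complex \<gamma> \<beta> * a
        - Complex k \<nu> * (complex_of_real w * a) + coord h j)"
      by (simp add: coord_pfield \<sigma> a_def b_def b'_def c_def w_def scaleR_conv_of_real)
    have "(cmod a)\<^sup>2 = inner a a" by (simp add: power2_norm_eq_inner)
    also have "\<dots> = inner (coord y j) a + eps * (inner (c * (2 * a - b - b')) a - inner (Complex \<gamma> \<beta> * a) a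
        - inner (Complex k \<nu> * (complex_of_real w * a)) a + inner (coord h j) a)"
      by (subst (1) a) (simp add: inner_add_left inner_diff_left)
    also have "inner (c * (2 * a - b - b')) a = 2 * lam * (cmod a)\<^sup>2 - inner (c * b) a - inner (c * b') a"
    proof -
      have "c * (2 * a - b - b') = 2 *\<^sub>R (c * a) - c * b - c * b'"
        by (simp add: algebra_simps scaleR_conv_of_real)
      moreover have "inner (c * a) a = lam * (cmod a)\<^sup>2"
        by (simp add: inner_mult_self c)
      ultimately show ?thesis by (simp add: inner_diff_left)
    qed
    also have "inner (Complex \<gamma> \<beta> * a) a = \<gamma> * (cmod a)\<^sup>2"
      by (simp add: inner_mult_self)
    also have "inner (Complex k \<nu> * (complex_of_real w * a)) a = k * cmod a powr (p + 2)"
    proof -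
      have "inner (Complex k \<nu> * (complex_of_real w * a)) a = k * (w * (cmod a)\<^sup>2)"
        using inner_mult_self [of "Complex k \<nu> * complex_of_real w" a] by (simp add: mult.assoc)
      also have "w * (cmod a)\<^sup>2 = cmod a powr (p + 2)"
        by (cases "a = 0") (simp_all add: w_def powr_add)
      finally show ?thesis .
    qed
    finally have eq: "(cmod a)\<^sup>2 = inner (coord y j) a + eps * (2 * lam * (cmod a)\<^sup>2 - inner (c * b) a
        - inner (c * b') a - \<gamma> * (cmod a)\<^sup>2 - k * cmod a powr (p + 2) + inner (coord h j) a)" .
    have young: "inner (coord h j) a \<le> k * cmod a powr (p + 2) + young_const * cmod (coord h j) powr q"
    proof -
      have "inner (coord h j) a \<le> cmod a * cmod (coord h j)"
        using norm_cauchy_schwarz [of "coord h j" a] by (simp add: mult.commute)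
      also have "\<dots> \<le> k * cmod a powr (p + 2) + young_const * cmod (coord h j) powr q"
        using Young_powr [of "cmod a" "cmod (coord h j)" k p] params by (simp add: young_const_def q_def)
      finally show ?thesis .
    qed
    have "(cmod a)\<^sup>2 \<le> ((cmod a)\<^sup>2 + (cmod (coord y j))\<^sup>2) * (1 / 2) + eps * (2 * lam * (cmod a)\<^sup>2
        - inner (c * b) a - inner (c * b') a - \<gamma> * (cmod a)\<^sup>2 + young_const * cmod (coord h j) powr q)"
    proof -
      have "eps * (2 * lam * (cmod a)\<^sup>2 - inner (c * b) a
          - inner (c * b') a - \<gamma> * (cmod a)\<^sup>2 - k * cmod a powr (p + 2) + inner (coord h j) a)
        \<le> eps * (2 * lam * (cmod a)\<^sup>2
          - inner (c * b) a - inner (c * b') a - \<gamma> * (cmod a)\<^sup>2 + young_const * cmod (coord h j) powr q)"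
        using young eps by (intro mult_left_mono) auto
      moreover have "inner (coord y j) a \<le> ((cmod a)\<^sup>2 + (cmod (coord y j))\<^sup>2) * (1 / 2)"
        using inner_le_half_squares [of "coord y j" a] by simp
      ultimately show ?thesis by (intro order_trans [OF eq [THEN eq_refl] add_mono])
    qed
    from mult_left_mono [OF this \<theta>(1) [of j]]
    have "\<theta> j * (cmod a)\<^sup>2 \<le> (\<theta> j * (cmod a)\<^sup>2 + \<theta> j * (cmod (coord y j))\<^sup>2) * (1 / 2)
      + eps * (2 * lam * (\<theta> j * (cmod a)\<^sup>2) - \<theta> j * inner (c * b) a - \<theta> j * inner (c * b') a
        - \<gamma> * (\<theta> j * (cmod a)\<^sup>2) + young_const * (\<theta> j * cmod (coord h j) powr q))"
      by (simp add: algebra_simps)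
    also have "\<dots> \<le> (\<theta> j * (cmod a)\<^sup>2 + \<theta> j * (cmod (coord y j))\<^sup>2) * (1 / 2)
      + eps * ((3 * lam - \<gamma>) * (\<theta> j * (cmod a)\<^sup>2) + lam * (\<theta> (\<sigma> j) * (cmod b)\<^sup>2)
        + (f (\<sigma> j) + - f j) + 2 * (d * cmod c) * ((cmod a)\<^sup>2 + (cmod b)\<^sup>2)
        + young_const * (\<theta> j * cmod (coord h j) powr q))"
    proof (intro add_left_mono mult_left_mono)
      have "f (\<sigma> j) = \<theta> (\<sigma> j) * inner (c * a) b" "f j = \<theta> j * inner (c * b') a"
        by (simp_all add: f_def a_def b_def b'_def inv_f_f [OF bij_is_inj [OF \<sigma>]])
      moreover have "2 * lam * (\<theta> j * (cmod a)\<^sup>2) - \<theta> j * inner (c * b) a - \<theta> (\<sigma> j) * inner (c * a) b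
        \<le> lam * (3 * (\<theta> j * (cmod a)\<^sup>2) + \<theta> (\<sigma> j) * (cmod b)\<^sup>2) + 2 * (d * cmod c) * ((cmod a)\<^sup>2 + (cmod b)\<^sup>2)"
        using weighted_edge_bound [OF _ \<theta>(1) d, of c j a b] params by (simp add: c)
      ultimately show "2 * lam * (\<theta> j * (cmod a)\<^sup>2) - \<theta> j * inner (c * b) a - \<theta> j * inner (c * b') a
          - \<gamma> * (\<theta> j * (cmod a)\<^sup>2) + young_const * (\<theta> j * cmod (coord h j) powr q)
        \<le> (3 * lam - \<gamma>) * (\<theta> j * (cmod a)\<^sup>2) + lam * (\<theta> (\<sigma> j) * (cmod b)\<^sup>2)
          + (f (\<sigma> j) + - f j) + 2 * (d * cmod c) * ((cmod a)\<^sup>2 + (cmod b)\<^sup>2)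
          + young_const * (\<theta> j * cmod (coord h j) powr q)"
        by (simp add: algebra_simps)
    qed (use eps in simp)
    finally show ?thesis by (simp only: a_def b_def)
  qed
  have "wsum \<theta> u \<le> (wsum \<theta> u + wsum \<theta> y) * (1 / 2)
      + eps * ((3 * lam - \<gamma>) * wsum \<theta> u + lam * wsum \<theta> u
        + (X + - X) + 2 * (d * cmod c) * ((norm u)\<^sup>2 + (norm u)\<^sup>2) + young_const * H)"
    by (rule has_sum_mono [OF W(1) _ pointwise])
      (intro has_sum_add has_sum_cmult_right has_sum_cmult_left has_sum_uminusI W W' X X' N h norm_ell2_has_sum)
  then show ?thesis by (simp add: c_def algebra_simps)
qed

end


section \<open>The schemes as iterated maps of a ball\<close>

locale euler_system = lattice_system +
  fixes g :: "int \<Rightarrow> complex" and \<eta> Cp \<epsilon> :: real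
  assumes g: "(\<lambda>j. cmod (g j) powr ((p + 2) / (p + 1))) summable_on UNIV"
    and Cp: "0 < Cp"
    and nonlin_lipschitz: "\<And>r u v. 0 < r \<Longrightarrow> u \<in> cball 0 r \<Longrightarrow> v \<in> cball 0 r \<Longrightarrow>
      norm (nonlin p u - nonlin p v) \<le> Cp * r powr p * norm (u - v)"
    and \<eta>: "0 \<le> \<eta>"
    and \<epsilon>: "0 < \<epsilon>" "\<epsilon> \<le> eps_star lam \<mu> \<gamma> \<beta> k \<nu> p g Cp \<eta>"
begin

abbreviation (input) "q \<equiv> (p + 2) / (p + 1)"
abbreviation "R \<equiv> r_star lam \<gamma> k p g \<eta>"
abbreviation "\<delta> \<equiv> \<gamma> - 4 * lam"
abbreviation "forcing \<equiv> Abs_ell2 g"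
abbreviation "M \<equiv> M_const lam \<mu> \<gamma> \<beta> k \<nu> p forcing (R + 1)"
abbreviation "L \<equiv> L_const lam \<mu> \<gamma> \<beta> k \<nu> p Cp (R + 1)"
abbreviation "g_sum \<equiv> (\<Sum>\<^sub>\<infinity>j. cmod (g j) powr q)"

text \<open>
  A pair of a lattice geometry and a forcing for which all bounds hold with the constants of the
  full system. The truncated systems and the full system are instances.
\<close>
definition admissible :: "(int \<Rightarrow> int) \<Rightarrow> ell2 \<Rightarrow> bool"
  where "admissible \<sigma> h \<longleftrightarrow> bij \<sigma> \<and> (\<forall>j. cmod (coord h j) \<le> cmod (g j))"

lemma coord_forcing: "coord forcing = g"
  using params by (intro coord_Abs_ell2_of_powr_summable [OF _ _ g]) (auto simp: field_simps)

lemma admissible_shift: "admissible (\<lambda>j. j + 1) forcing"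
  by (simp add: admissible_def bij_shift coord_forcing)

lemma admissible_cyclic: "admissible (cyclic_shift m) (null_expansion m g)"
  by (simp add: admissible_def bij_cyclic_shift)

lemma g_sum_nonneg: "0 \<le> g_sum"
  by (intro infsum_nonneg) simp

text \<open>
  The radius is chosen such that the damping \<open>\<delta> * R\<^sup>2\<close> dominates the contribution of the forcing to
  the energy.
\<close>
lemma R_nonneg: "0 \<le> R" and R_square: "\<delta> * R\<^sup>2 = \<delta> * \<eta> + young_const * g_sum"
proof -
  have "0 \<le> young_const * g_sum" using young_const_nonneg g_sum_nonneg by simp
  moreover have "c1_const k p g = young_const * g_sum" by (simp add: c1_const_def young_const_def)
  ultimately have "0 \<le> \<eta> + c1_const k p g / \<delta>" using params \<eta> by simp
  then show "0 \<le> R" "\<delta> * R\<^sup>2 = \<delta> * \<eta> + young_const * g_sum"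
    using params \<open>c1_const k p g = _\<close> by (simp_all add: r_star_def field_simps)
qed

lemma norm_nonlin_le: "norm (nonlin p u) \<le> norm u powr p * norm u"
proof (rule norm_mono_coord)
  show "cmod (coord (nonlin p u) j) \<le> norm u powr p * cmod (coord u j)" for j
    using params by (auto simp: coord_nonlin norm_mult intro!: mult_right_mono powr_mono2 coord_le_norm)
qed simp

lemma pfield_bound:
  assumes "admissible \<sigma> h" "u \<in> cball 0 (R + 1)"
  shows "norm (pfield \<sigma> h u) \<le> M"
proof -
  have u: "norm u \<le> R + 1" and R1: "0 < R + 1" using assms R_nonneg by auto
  have "norm (Complex lam \<mu> *\<^sub>C plap \<sigma> u) \<le> (lam + \<bar>\<mu>\<bar>) * (4 * (R + 1))"
    unfolding norm_scaleC using cmod_le [of "Complex lam \<mu>"] params assms(1) u norm_plap_le [of \<sigma> u]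
    by (intro mult_mono) (auto simp: admissible_def)
  moreover have "norm (Complex \<gamma> \<beta> *\<^sub>C u) \<le> (\<gamma> + \<bar>\<beta>\<bar>) * (R + 1)"
    unfolding norm_scaleC using cmod_le [of "Complex \<gamma> \<beta>"] params u by (intro mult_mono) auto
  moreover have "norm (Complex k \<nu> *\<^sub>C nonlin p u) \<le> (k + \<bar>\<nu>\<bar>) * (R + 1) powr (p + 1)"
  proof -
    have "norm (nonlin p u) \<le> (R + 1) powr p * (R + 1)"
      using params u by (intro order_trans [OF norm_nonlin_le] mult_mono powr_mono2) auto
    also have "\<dots> = (R + 1) powr (p + 1)" using R1 by (simp add: powr_add)
    finally show ?thesis
      unfolding norm_scaleC using cmod_le [of "Complex k \<nu>"] params by (intro mult_mono) auto
  qed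
  moreover have "norm h \<le> norm forcing"
    using norm_mono_coord [of h 1 forcing] assms(1) by (simp add: admissible_def coord_forcing)
  moreover have "norm (pfield \<sigma> h u) \<le> norm (Complex lam \<mu> *\<^sub>C plap \<sigma> u) + norm (Complex \<gamma> \<beta> *\<^sub>C u)
      + norm (Complex k \<nu> *\<^sub>C nonlin p u) + norm h"
    unfolding pfield_def
    using norm_triangle_ineq [of "Complex lam \<mu> *\<^sub>C plap \<sigma> u - Complex \<gamma> \<beta> *\<^sub>C u - Complex k \<nu> *\<^sub>C nonlin p u" h]
      norm_triangle_ineq4 [of "Complex lam \<mu> *\<^sub>C plap \<sigma> u - Complex \<gamma> \<beta> *\<^sub>C u" "Complex k \<nu> *\<^sub>C nonlin p u"]
      norm_triangle_ineq4 [of "Complex lam \<mu> *\<^sub>C plap \<sigma> u" "Complex \<gamma> \<beta> *\<^sub>C u"]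
    by linarith
  ultimately show ?thesis by (simp add: M_const_def algebra_simps)
qed

lemma pfield_lipschitz:
  assumes "admissible \<sigma> h" "u \<in> cball 0 (R + 1)" "v \<in> cball 0 (R + 1)"
  shows "norm (pfield \<sigma> h u - pfield \<sigma> h v) \<le> L * norm (u - v)"
proof -
  have \<sigma>: "bij \<sigma>" and R1: "0 < R + 1" using assms R_nonneg by (auto simp: admissible_def)
  have "norm (Complex lam \<mu> *\<^sub>C plap \<sigma> (u - v)) \<le> (lam + \<bar>\<mu>\<bar>) * (4 * norm (u - v))"
    unfolding norm_scaleC using cmod_le [of "Complex lam \<mu>"] params norm_plap_le [OF \<sigma>, of "u - v"]
    by (intro mult_mono) auto
  moreover have "norm (Complex \<gamma> \<beta> *\<^sub>C (u - v)) \<le> (\<gamma> + \<bar>\<beta>\<bar>) * norm (u - v)"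
    unfolding norm_scaleC using cmod_le [of "Complex \<gamma> \<beta>"] params by (intro mult_mono) auto
  moreover have "norm (Complex k \<nu> *\<^sub>C (nonlin p u - nonlin p v))
      \<le> (k + \<bar>\<nu>\<bar>) * (Cp * (R + 1) powr p * norm (u - v))"
    unfolding norm_scaleC using cmod_le [of "Complex k \<nu>"] params nonlin_lipschitz [OF R1 assms(2,3)]
    by (intro mult_mono) auto
  moreover have "pfield \<sigma> h u - pfield \<sigma> h v = Complex lam \<mu> *\<^sub>C plap \<sigma> (u - v)
      - Complex \<gamma> \<beta> *\<^sub>C (u - v) - Complex k \<nu> *\<^sub>C (nonlin p u - nonlin p v)"
    by (simp add: pfield_def plap_diff [OF \<sigma>] scaleC_diff algebra_simps)
  then have "norm (pfield \<sigma> h u - pfield \<sigma> h v) \<le> norm (Complex lam \<mu> *\<^sub>C plap \<sigma> (u - v))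
      + norm (Complex \<gamma> \<beta> *\<^sub>C (u - v)) + norm (Complex k \<nu> *\<^sub>C (nonlin p u - nonlin p v))"
    using norm_triangle_ineq4 [of "Complex lam \<mu> *\<^sub>C plap \<sigma> (u - v) - Complex \<gamma> \<beta> *\<^sub>C (u - v)"
        "Complex k \<nu> *\<^sub>C (nonlin p u - nonlin p v)"]
      norm_triangle_ineq4 [of "Complex lam \<mu> *\<^sub>C plap \<sigma> (u - v)" "Complex \<gamma> \<beta> *\<^sub>C (u - v)"]
    by simp
  ultimately show ?thesis by (simp add: L_const_def algebra_simps)
qed

lemma step_size: "\<epsilon> * M \<le> 1" "0 \<le> L" "\<epsilon> * L < 1"
proof -
  have R1: "0 < R + 1" using R_nonneg by simp
  have "0 < (4 * lam + 4 * \<bar>\<mu>\<bar> + \<gamma> + \<bar>\<beta>\<bar>) * (R + 1)"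
    using params by (intro mult_pos_pos R1) linarith
  moreover have "0 \<le> (k + \<bar>\<nu>\<bar>) * (R + 1) powr (p + 1)" using params by simp
  ultimately have M: "0 < M" using norm_ge_zero [of forcing] unfolding M_const_def by linarith
  have "0 \<le> Cp * (R + 1) powr p * (k + \<bar>\<nu>\<bar>)" using Cp params by simp
  then show L: "0 \<le> L" unfolding L_const_def using params by linarith
  have "\<epsilon> \<le> 1 / M" "\<epsilon> \<le> 1 / (1 + L)" using \<epsilon> by (simp_all add: eps_star_def Let_def)
  then show "\<epsilon> * M \<le> 1" "\<epsilon> * L < 1" using M L \<epsilon> by (simp_all add: field_simps)
qed

lemma forcing_weighted_sum:
  assumes "admissible \<sigma> h" "\<And>j. 0 \<le> \<theta> j" "\<And>j. \<theta> j \<le> 1"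
  shows "((\<lambda>j. \<theta> j * cmod (coord h j) powr q) has_sum (\<Sum>\<^sub>\<infinity>j. \<theta> j * cmod (coord h j) powr q)) UNIV"
    and "(\<Sum>\<^sub>\<infinity>j. \<theta> j * cmod (coord h j) powr q) \<le> (\<Sum>\<^sub>\<infinity>j. \<theta> j * cmod (g j) powr q)"
proof -
  have q: "0 \<le> q" using params by simp
  have le: "cmod (coord h j) powr q \<le> cmod (g j) powr q" for j
    using assms(1) q by (intro powr_mono2) (auto simp: admissible_def)
  have "(\<lambda>j. \<theta> j * cmod (g j) powr q) summable_on UNIV"
    by (rule summable_on_comparison_test [OF g]) (use assms in \<open>auto intro: mult_left_le_one_le\<close>)
  moreover from this have "(\<lambda>j. \<theta> j * cmod (coord h j) powr q) summable_on UNIV"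
    by (rule summable_on_comparison_test) (use assms le in \<open>auto intro: mult_left_mono\<close>)
  ultimately show "((\<lambda>j. \<theta> j * cmod (coord h j) powr q) has_sum (\<Sum>\<^sub>\<infinity>j. \<theta> j * cmod (coord h j) powr q)) UNIV"
    and "(\<Sum>\<^sub>\<infinity>j. \<theta> j * cmod (coord h j) powr q) \<le> (\<Sum>\<^sub>\<infinity>j. \<theta> j * cmod (g j) powr q)"
    using assms(2) le by (auto intro!: infsum_mono mult_left_mono)
qed

text \<open>
  A solution of the implicit equation, wherever the contraction argument finds it, returns to the
  smaller ball: this is the energy estimate with weight \<open>1\<close>, for which the error term vanishes.
\<close>
lemma implicit_solution_in_ball:
  assumes "admissible \<sigma> h" "y \<in> cball 0 R" "u = y + \<epsilon> *\<^sub>R pfield \<sigma> h u"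
  shows "u \<in> cball 0 R"
proof -
  have "(1 + 2 * \<epsilon> * \<delta>) * wsum (\<lambda>_. 1) u \<le> wsum (\<lambda>_. 1) y
      + 2 * \<epsilon> * (young_const * (\<Sum>\<^sub>\<infinity>j. 1 * cmod (coord h j) powr q) + 4 * (0 * cmod (Complex lam \<mu>)) * (norm u)\<^sup>2)"
    using assms(1) forcing_weighted_sum(1) [OF assms(1), of "\<lambda>_. 1"] \<epsilon>(1) assms(3)
    by (intro weighted_energy_estimate) (auto simp: admissible_def)
  also have "\<dots> \<le> R\<^sup>2 + 2 * \<epsilon> * (young_const * g_sum)"
    using assms(2) \<epsilon>(1) forcing_weighted_sum(2) [OF assms(1), of "\<lambda>_. 1"] young_const_nonneg
    by (intro add_mono mult_left_mono) (auto simp: wsum_one intro: power_mono mult_left_mono)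
  also have "\<dots> \<le> (1 + 2 * \<epsilon> * \<delta>) * R\<^sup>2"
  proof -
    have "young_const * g_sum \<le> \<delta> * R\<^sup>2" using R_square \<eta> params by simp
    from mult_left_mono [OF this, of "2 * \<epsilon>"] \<epsilon>(1) show ?thesis by (simp add: algebra_simps)
  qed
  finally have "(norm u)\<^sup>2 \<le> R\<^sup>2" using \<epsilon>(1) params by (simp add: wsum_one add_pos_pos)
  then have "norm u \<le> R" by (rule power2_le_imp_le [OF _ R_nonneg])
  then show ?thesis by simp
qed

definition step :: "(int \<Rightarrow> int) \<Rightarrow> ell2 \<Rightarrow> ell2 \<Rightarrow> ell2"
  where "step \<sigma> h y = (THE u. u \<in> cball 0 R \<and> u = y + \<epsilon> *\<^sub>R pfield \<sigma> h u)"

lemma ex1_step: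
  assumes "admissible \<sigma> h" "y \<in> cball 0 R"
  shows "\<exists>!u. u \<in> cball 0 R \<and> u = y + \<epsilon> *\<^sub>R pfield \<sigma> h u"
proof -
  have "\<exists>!u. u \<in> cball 0 (R + 1) \<and> u = y + \<epsilon> *\<^sub>R pfield \<sigma> h u"
    by (rule ex1_implicit_step [OF R_nonneg \<epsilon>(1) pfield_bound [OF assms(1)] step_size(1)
          pfield_lipschitz [OF assms(1)] step_size(2,3) assms(2)])
  moreover have "cball (0::ell2) R \<subseteq> cball 0 (R + 1)" by auto
  ultimately show ?thesis using implicit_solution_in_ball [OF assms] by blast
qed

lemma
  assumes "admissible \<sigma> h" "y \<in> cball 0 R"
  shows step_in_ball: "step \<sigma> h y \<in> cball 0 R"
    and step_eq: "step \<sigma> h y = y + \<epsilon> *\<^sub>R pfield \<sigma> h (step \<sigma> h y)"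
  by (rule theI' [OF ex1_step [OF assms], folded step_def, THEN conjunct1])
    (rule theI' [OF ex1_step [OF assms], folded step_def, THEN conjunct2])

lemma step_unique:
  assumes "admissible \<sigma> h" "y \<in> cball 0 R" "u \<in> cball 0 R" "u = y + \<epsilon> *\<^sub>R pfield \<sigma> h u"
  shows "step \<sigma> h y = u"
  unfolding step_def by (rule the1_equality [OF ex1_step [OF assms(1,2)] conjI [OF assms(3,4)]])

lemma step_pow_in_ball:
  "admissible \<sigma> h \<Longrightarrow> y \<in> cball 0 R \<Longrightarrow> (step \<sigma> h ^^ n) y \<in> cball 0 R"
  by (induction n) (simp_all only: funpow.simps id_apply comp_apply step_in_ball)

lemma euler_eq_step_pow:
  assumes "admissible \<sigma> h" "y \<in> cball 0 R"
  shows "euler (pfield \<sigma> h) (cball 0 R) \<epsilon> n y = (step \<sigma> h ^^ n) y"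
proof -
  let ?P = "\<lambda>u :: nat \<Rightarrow> ell2. u 0 = y \<and> (\<forall>n. u n \<in> cball 0 R) \<and> (\<forall>n\<ge>1. u n = u (n - 1) + \<epsilon> *\<^sub>R pfield \<sigma> h (u n))"
  have "(THE u. ?P u) = (\<lambda>n. (step \<sigma> h ^^ n) y)"
  proof (rule the_equality)
    have "(step \<sigma> h ^^ n) y = (step \<sigma> h ^^ (n - 1)) y + \<epsilon> *\<^sub>R pfield \<sigma> h ((step \<sigma> h ^^ n) y)" if "n \<ge> 1" for n
    proof -
      from that obtain m where "n = Suc m" by (cases n) simp_all
      then show ?thesis
        by (simp only: funpow.simps comp_apply diff_Suc_1) (rule step_eq [OF assms(1) step_pow_in_ball [OF assms]])
    qed
    then show "?P (\<lambda>n. (step \<sigma> h ^^ n) y)" using step_pow_in_ball [OF assms] by auto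
    fix u assume u: "?P u"
    have "u n = (step \<sigma> h ^^ n) y" for n :: nat
    proof (induction n)
      case (Suc n)
      have "u n \<in> cball 0 R" "u (Suc n) \<in> cball 0 R" using u by blast+
      moreover have "u (Suc n) = u n + \<epsilon> *\<^sub>R pfield \<sigma> h (u (Suc n))"
        using u by (metis diff_Suc_1 le_add1 plus_1_eq_Suc)
      ultimately have "step \<sigma> h (u n) = u (Suc n)" by (rule step_unique [OF assms(1)])
      with Suc show ?case by simp
    qed (use u in simp)
    then show "u = (\<lambda>n. (step \<sigma> h ^^ n) y)" by blast
  qed
  then show ?thesis by (simp add: euler_def)
qed

text \<open>
  Iterating the energy estimate: the initial weighted mass is forgotten geometrically, and what
  remains is the fixed point of \<open>w \<mapsto> (w + 2 * \<epsilon> * Q) / (1 + 2 * \<epsilon> * \<delta>)\<close>, which is \<open>Q / \<delta>\<close>.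
\<close>
lemma step_pow_decay:
  assumes adm: "admissible \<sigma> h" and y: "y \<in> cball 0 R"
    and \<theta>: "\<And>j. 0 \<le> \<theta> j" "\<And>j. \<theta> j \<le> 1" and d: "\<And>j. \<bar>\<theta> j - \<theta> (\<sigma> j)\<bar> \<le> d"
  shows "wsum \<theta> ((step \<sigma> h ^^ n) y) \<le> wsum \<theta> y / (1 + 2 * \<epsilon> * \<delta>) ^ n
    + (young_const * (\<Sum>\<^sub>\<infinity>j. \<theta> j * cmod (coord h j) powr q) + 4 * (d * cmod (Complex lam \<mu>)) * R\<^sup>2) / \<delta>"
    (is "_ \<le> _ + ?Q / \<delta>")
proof (induction n)
  case 0
  have "0 \<le> d" by (rule order_trans [OF abs_ge_zero d])
  then have "0 \<le> ?Q"
    using \<theta> young_const_nonneg by (intro add_nonneg_nonneg mult_nonneg_nonneg infsum_nonneg) auto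
  then show ?case using params by simp
next
  case (Suc n)
  define x x' a where "x = (step \<sigma> h ^^ n) y" and "x' = step \<sigma> h x" and "a = 1 + 2 * \<epsilon> * \<delta>"
  have "0 < \<epsilon> * \<delta>" using params \<epsilon>(1) by simp
  then have a: "0 < a" by (simp add: a_def)
  have "0 \<le> d" by (rule order_trans [OF abs_ge_zero d])
  have x: "x \<in> cball 0 R" unfolding x_def by (rule step_pow_in_ball [OF adm y])
  then have "norm x' \<le> R" using step_in_ball [OF adm] by (simp add: x'_def)
  have "a * wsum \<theta> x' \<le> wsum \<theta> x
      + 2 * \<epsilon> * (young_const * (\<Sum>\<^sub>\<infinity>j. \<theta> j * cmod (coord h j) powr q) + 4 * (d * cmod (Complex lam \<mu>)) * (norm x')\<^sup>2)"
    unfolding a_def x'_def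
    by (rule weighted_energy_estimate
        [OF adm [unfolded admissible_def, THEN conjunct1] \<theta> d \<epsilon>(1) step_eq [OF adm x] forcing_weighted_sum(1) [OF adm, of \<theta>, OF \<theta>]])
  also have "\<dots> \<le> (wsum \<theta> y / a ^ n + ?Q / \<delta>) + 2 * \<epsilon> * ?Q"
    using Suc.IH \<epsilon>(1) young_const_nonneg \<open>norm x' \<le> R\<close> \<open>0 \<le> d\<close> unfolding x_def a_def
    by (intro add_mono mult_left_mono power_mono) auto
  also have "\<dots> = a * (wsum \<theta> y / a ^ Suc n + ?Q / \<delta>)"
    using a params by (simp add: field_simps) (simp add: a_def algebra_simps)
  finally show ?case using a by (simp add: x'_def x_def a_def)
qed

text \<open>
  A step depends continuously on the initial value and on the system. The two fields need only be compared
  at the end point of the second step, which is fixed when the first system varies.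
\<close>
lemma step_diff_le:
  assumes adm: "admissible \<sigma> h" "admissible \<tau> h'" and y: "y \<in> cball 0 R" "y' \<in> cball 0 R"
  defines "v \<equiv> step \<tau> h' y'"
  shows "(1 - \<epsilon> * L) * norm (step \<sigma> h y - v) \<le> norm (y - y') + \<epsilon> * norm (pfield \<sigma> h v - pfield \<tau> h' v)"
proof -
  define u where "u = step \<sigma> h y"
  have big: "u \<in> cball 0 (R + 1)" "v \<in> cball 0 (R + 1)"
    using step_in_ball [OF adm(1) y(1)] step_in_ball [OF adm(2) y(2)] by (auto simp: u_def v_def)
  have "u - v = (y - y') + \<epsilon> *\<^sub>R (pfield \<sigma> h u - pfield \<sigma> h v) + \<epsilon> *\<^sub>R (pfield \<sigma> h v - pfield \<tau> h' v)"
  proof -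
    have "u - v = (y + \<epsilon> *\<^sub>R pfield \<sigma> h u) - (y' + \<epsilon> *\<^sub>R pfield \<tau> h' v)"
      by (rule arg_cong2 [where f = "(-)"])
        (unfold u_def v_def, rule step_eq [OF adm(1) y(1)], rule step_eq [OF adm(2) y(2)])
    then show ?thesis by (simp add: algebra_simps)
  qed
  also have "norm \<dots> \<le> norm (y - y') + norm (\<epsilon> *\<^sub>R (pfield \<sigma> h u - pfield \<sigma> h v))
      + norm (\<epsilon> *\<^sub>R (pfield \<sigma> h v - pfield \<tau> h' v))"
    by (intro order_trans [OF norm_triangle_ineq] add_right_mono norm_triangle_ineq)
  also have "\<dots> \<le> norm (y - y') + \<epsilon> * (L * norm (u - v)) + \<epsilon> * norm (pfield \<sigma> h v - pfield \<tau> h' v)"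
    using pfield_lipschitz [OF adm(1) big] \<epsilon>(1) by simp
  finally show ?thesis by (simp add: u_def algebra_simps)
qed

end


section \<open>Tails of the orbits\<close>

text \<open>
  The cutoff vanishes for \<open>\<bar>j\<bar> \<le> K\<close> and equals \<open>1\<close> for \<open>\<bar>j\<bar> \<ge> 2 * K\<close>. It is even, hence it takes the same value
  at the two ends of the window, which the periodic boundary condition joins.
\<close>
definition ramp :: "real \<Rightarrow> int \<Rightarrow> real"
  where "ramp K j = min 1 (max 0 (\<bar>real_of_int j\<bar> / K - 1))"

lemma ramp_bounds: "0 \<le> ramp K j" "ramp K j \<le> 1"
  by (auto simp: ramp_def)

lemma ramp_eq_0: "0 < K \<Longrightarrow> \<bar>real_of_int j\<bar> \<le> K \<Longrightarrow> ramp K j = 0"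
  by (simp add: ramp_def)

lemma ramp_eq_1: "0 < K \<Longrightarrow> 2 * K \<le> \<bar>real_of_int j\<bar> \<Longrightarrow> ramp K j = 1"
  by (simp add: ramp_def field_simps)

lemma ramp_cyclic_shift:
  assumes "0 < K"
  shows "\<bar>ramp K j - ramp K (cyclic_shift m j)\<bar> \<le> 1 / K"
proof -
  have "\<bar>ramp K j - ramp K i\<bar> \<le> \<bar>\<bar>real_of_int j\<bar> / K - \<bar>real_of_int i\<bar> / K\<bar>" for i
    unfolding ramp_def by linarith
  also have "\<bar>\<bar>real_of_int j\<bar> / K - \<bar>real_of_int i\<bar> / K\<bar> \<le> 1 / K" if "i = cyclic_shift m j" for i
  proof -
    have "\<bar>\<bar>real_of_int j\<bar> - \<bar>real_of_int i\<bar>\<bar> \<le> 1"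
      using that by (auto simp: cyclic_shift_def idx_def)
    then have "\<bar>\<bar>real_of_int j\<bar> - \<bar>real_of_int i\<bar>\<bar> / K \<le> 1 / K"
      using assms by (intro divide_right_mono) auto
    then show ?thesis using assms by (simp add: diff_divide_distrib [symmetric])
  qed
  finally show ?thesis by simp
qed

lemma tail_le_wsum_ramp:
  assumes "0 < K"
  shows "tail {j. \<bar>real_of_int j\<bar> \<le> 2 * K} u \<le> wsum (ramp K) u"
  using assms ramp_bounds by (intro wsum_mono) (auto simp: indicator_def ramp_eq_1)

lemma finite_abs_le: "finite {j::int. \<bar>real_of_int j\<bar> \<le> K}"
proof (rule finite_subset)
  show "{j::int. \<bar>real_of_int j\<bar> \<le> K} \<subseteq> {- \<lceil>K\<rceil>..\<lceil>K\<rceil>}" by (auto simp: abs_le_iff) linarith+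
qed simp

lemma ramp_weighted_sum_small:
  fixes a :: "int \<Rightarrow> real"
  assumes a: "a summable_on UNIV" "\<And>j. 0 \<le> a j" and e: "0 < e"
  shows "\<exists>K0>0. \<forall>K\<ge>K0. (\<Sum>\<^sub>\<infinity>j. ramp K j * a j) \<le> e"
proof -
  obtain F where F: "finite F" "dist (sum a F) (infsum a UNIV) \<le> e"
    using infsum_finite_approximation [OF a(1) e] by auto
  obtain K0 :: real where K0: "0 < K0" "\<And>j. j \<in> F \<Longrightarrow> \<bar>real_of_int j\<bar> \<le> K0"
  proof
    show "0 < 1 + (\<Sum>j\<in>F. \<bar>real_of_int j\<bar>)" by (intro add_pos_nonneg sum_nonneg) auto
    show "\<bar>real_of_int j\<bar> \<le> 1 + (\<Sum>j\<in>F. \<bar>real_of_int j\<bar>)" if "j \<in> F" for j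
      using member_le_sum [OF that, of "\<lambda>j. \<bar>real_of_int j\<bar>"] F(1) by simp
  qed
  have "(\<Sum>\<^sub>\<infinity>j. ramp K j * a j) \<le> e" if K: "K \<ge> K0" for K
  proof -
    have FF: "((\<lambda>j. indicat_real F j * a j) has_sum sum a F) UNIV"
      by (rule has_sum_finite_neutralI [OF F(1)]) (auto simp: indicator_def)
    have "(\<lambda>j. ramp K j * a j) summable_on UNIV"
      by (rule summable_on_comparison_test [OF a(1)])
        (use ramp_bounds a(2) in \<open>auto intro: mult_left_le_one_le\<close>)
    then have "((\<lambda>j. ramp K j * a j + indicat_real F j * a j) has_sum ((\<Sum>\<^sub>\<infinity>j. ramp K j * a j) + sum a F)) UNIV"
      by (intro has_sum_add FF has_sum_infsum)
    then have "(\<Sum>\<^sub>\<infinity>j. ramp K j * a j) + sum a F \<le> infsum a UNIV"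
    proof (rule has_sum_mono [OF _ has_sum_infsum [OF a(1)]])
      fix j
      have "ramp K j = 0" if "j \<in> F"
        using K0(1) K order_trans [OF K0(2) [OF that] K] by (intro ramp_eq_0) auto
      then show "ramp K j * a j + indicat_real F j * a j \<le> a j"
        using a(2) [of j] ramp_bounds [of K j] by (cases "j \<in> F") (auto intro: mult_left_le_one_le)
    qed
    with F(2) show ?thesis by (simp add: dist_real_def)
  qed
  with K0(1) show ?thesis by blast
qed

context euler_system
begin

abbreviation trunc_step :: "nat \<Rightarrow> ell2 \<Rightarrow> ell2"
  where "trunc_step m \<equiv> step (cyclic_shift m) (null_expansion m g)"

abbreviation full_step :: "ell2 \<Rightarrow> ell2"
  where "full_step \<equiv> step (\<lambda>j. j + 1) forcing"

definition trunc_ball_ell2 :: "nat \<Rightarrow> ell2 set"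
  where "trunc_ball_ell2 m = {u \<in> cball 0 R. \<forall>j. j \<notin> idx m \<longrightarrow> coord u j = 0}"

text \<open>
  The energy estimate with the indicator of the complement of the window, which is invariant under the
  cyclic shift and on which both the forcing and the initial value vanish.
\<close>
lemma trunc_step_in_trunc_ball:
  assumes "y \<in> trunc_ball_ell2 m"
  shows "trunc_step m y \<in> trunc_ball_ell2 m"
proof -
  define \<theta> where "\<theta> = indicat_real (- idx m)"
  define u where "u = trunc_step m y"
  have \<theta>: "0 \<le> \<theta> j" "\<theta> j \<le> 1" for j by (auto simp: \<theta>_def)
  have y: "y \<in> cball 0 R" "\<And>j. j \<notin> idx m \<Longrightarrow> coord y j = 0"
    using assms by (auto simp: trunc_ball_ell2_def)
  have u: "u \<in> cball 0 R" unfolding u_def by (rule step_in_ball [OF admissible_cyclic y(1)])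
  have "\<theta> (cyclic_shift m j) = \<theta> j" for j by (auto simp: \<theta>_def cyclic_shift_def idx_def indicator_def)
  then have d: "\<bar>\<theta> j - \<theta> (cyclic_shift m j)\<bar> \<le> 0" for j by simp
  have "\<theta> j * (cmod (coord y j))\<^sup>2 = 0" for j
    using y(2) [of j] by (cases "j \<in> idx m") (simp_all add: \<theta>_def)
  then have "wsum \<theta> y = 0" unfolding wsum_def by (rule infsum_0)
  moreover have "(\<Sum>\<^sub>\<infinity>j. \<theta> j * cmod (coord (null_expansion m g) j) powr q) = 0"
    by (rule infsum_0) (simp add: \<theta>_def)
  ultimately have "wsum \<theta> u \<le> 0"
    using step_pow_decay [of "cyclic_shift m" "null_expansion m g" y \<theta> 0 1, OF admissible_cyclic y(1) \<theta> d]
    unfolding u_def by simp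
  then have "(\<Sum>\<^sub>\<infinity>j. \<theta> j * (cmod (coord u j))\<^sup>2) \<le> 0" by (simp add: wsum_def)
  then have zero: "\<theta> j * (cmod (coord u j))\<^sup>2 = 0" for j
    by (rule nonneg_infsum_le_0D) (use has_sum_imp_summable [OF wsum_has_sum [of \<theta> u, OF \<theta>]] \<theta> in auto)
  have "coord u j = 0" if "j \<notin> idx m" for j using zero [of j] that by (simp add: \<theta>_def)
  with u show ?thesis by (simp add: trunc_ball_ell2_def u_def)
qed

lemma trunc_step_pow_in_trunc_ball:
  "y \<in> trunc_ball_ell2 m \<Longrightarrow> (trunc_step m ^^ n) y \<in> trunc_ball_ell2 m"
  by (induction n) (simp_all add: trunc_step_in_trunc_ball)

text \<open>
  The cutoff at scale \<open>K\<close> leaves three contributions to the tail: the forcing beyond \<open>K\<close> and the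
  variation of the cutoff, both small for large \<open>K\<close> and independent of the size of the window, and
  the initial mass, which decays with the number of steps.
\<close>
lemma orbit_tails_small:
  assumes y: "\<And>i. y i \<in> cball 0 R" and n: "filterlim n at_top sequentially" and e: "0 < e"
  shows "\<exists>J. finite J \<and> (\<forall>\<^sub>F i in sequentially. tail J ((trunc_step (r i) ^^ n i) (y i)) \<le> e)"
proof -
  define e' where "e' = \<delta> * e / 4"
  define G where "G = (\<lambda>K. \<Sum>\<^sub>\<infinity>j. ramp K j * cmod (g j) powr q)"
  define c where "c = cmod (Complex lam \<mu>)"
  have e': "0 < e'" using e params by (simp add: e'_def)
  have pos: "0 < e' / (young_const + 1)" using e' young_const_nonneg by simp
  obtain K0 where K0: "0 < K0" "\<forall>K\<ge>K0. G K \<le> e' / (young_const + 1)"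
    using ramp_weighted_sum_small [OF g _ pos] unfolding G_def by auto
  \<comment> \<open>With this \<open>K\<close> the forcing and the variation of the cutoff contribute at most \<open>e / 4\<close> each after division by \<open>\<delta>\<close>, and \<open>e / 2\<close> is left for the initial mass.\<close>
  define K where "K = max K0 (4 * c * R\<^sup>2 / e')"
  have K: "0 < K" "K0 \<le> K" using K0(1) by (auto simp: K_def)
  have "4 * c * R\<^sup>2 / e' \<le> K" by (simp add: K_def)
  then have far: "4 * (1 / K * c) * R\<^sup>2 \<le> e'" using e' K by (simp add: field_simps)
  have "young_const * G K \<le> (young_const + 1) * (e' / (young_const + 1))"
    using K0(2) K(2) young_const_nonneg pos by (intro mult_mono) (auto simp: G_def intro!: infsum_nonneg mult_nonneg_nonneg ramp_bounds)
  also have "\<dots> = e'" using young_const_nonneg by simp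
  finally have forcing_small: "young_const * G K \<le> e'" .
  have "0 < \<epsilon> * \<delta>" using params \<epsilon>(1) by simp
  then have "(\<lambda>i. R\<^sup>2 / (1 + 2 * \<epsilon> * \<delta>) ^ n i) \<longlonglongrightarrow> 0"
    using filterlim_compose [OF LIMSEQ_divide_realpow_zero n, of "1 + 2 * \<epsilon> * \<delta>" "R\<^sup>2"] by simp
  then have "\<forall>\<^sub>F i in sequentially. R\<^sup>2 / (1 + 2 * \<epsilon> * \<delta>) ^ n i < e / 2"
    by (rule order_tendstoD) (use e in simp)
  then have "\<forall>\<^sub>F i in sequentially. tail {j. \<bar>real_of_int j\<bar> \<le> 2 * K} ((trunc_step (r i) ^^ n i) (y i)) \<le> e"
  proof eventually_elim
    case (elim i)
    define h where "h = null_expansion (r i) g"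
    have "tail {j. \<bar>real_of_int j\<bar> \<le> 2 * K} ((trunc_step (r i) ^^ n i) (y i))
        \<le> wsum (ramp K) ((trunc_step (r i) ^^ n i) (y i))"
      by (rule tail_le_wsum_ramp [OF K(1)])
    also have "\<dots> \<le> wsum (ramp K) (y i) / (1 + 2 * \<epsilon> * \<delta>) ^ n i
        + (young_const * (\<Sum>\<^sub>\<infinity>j. ramp K j * cmod (coord h j) powr q) + 4 * (1 / K * c) * R\<^sup>2) / \<delta>"
      unfolding h_def c_def
      by (intro step_pow_decay admissible_cyclic y ramp_bounds ramp_cyclic_shift K(1))
    also have "\<dots> \<le> R\<^sup>2 / (1 + 2 * \<epsilon> * \<delta>) ^ n i + (e' + e') / \<delta>"
    proof (intro add_mono divide_right_mono far)
      have "wsum (ramp K) (y i) \<le> (norm (y i))\<^sup>2" by (rule wsum_le_norm [OF ramp_bounds])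
      also have "\<dots> \<le> R\<^sup>2" using y [of i] by (intro power_mono) auto
      finally show "wsum (ramp K) (y i) \<le> R\<^sup>2" .
      have "young_const * (\<Sum>\<^sub>\<infinity>j. ramp K j * cmod (coord h j) powr q) \<le> young_const * G K"
        unfolding h_def G_def
        by (intro mult_left_mono forcing_weighted_sum(2) [OF admissible_cyclic] ramp_bounds young_const_nonneg)
      with forcing_small show "young_const * (\<Sum>\<^sub>\<infinity>j. ramp K j * cmod (coord h j) powr q) \<le> e'" by simp
    qed (use \<open>0 < \<epsilon> * \<delta>\<close> params in auto)
    also have "(e' + e') / \<delta> = e / 2" using params by (simp add: e'_def field_simps)
    also have "R\<^sup>2 / (1 + 2 * \<epsilon> * \<delta>) ^ n i + e / 2 \<le> e" using elim by linarith
    finally show ?case .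
  qed
  with finite_abs_le show ?thesis by blast
qed

text \<open>
  At a fixed sequence the truncated fields converge to the full one, as the cyclic shift agrees with
  the shift inside the window.
\<close>
lemma trunc_step_tendsto:
  assumes r: "strict_mono r" and x: "\<And>i. x i \<in> trunc_ball_ell2 (r i)" and w: "x \<longlonglongrightarrow> w"
  shows "(\<lambda>i. trunc_step (r i) (x i)) \<longlonglongrightarrow> full_step w"
proof -
  have xR: "x i \<in> cball 0 R" for i using x by (auto simp: trunc_ball_ell2_def)
  then have wR: "w \<in> cball 0 R" by (intro closed_sequentially [OF closed_cball _ w]) auto
  define v where "v = full_step w"
  have forcing: "(\<lambda>m. null_expansion m g) \<longlonglongrightarrow> forcing"
  proof (rule tendsto_ell2_norm_le)
    have ev: "\<forall>\<^sub>F m in sequentially. j \<in> idx m" for j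
      by (rule eventually_sequentiallyI [of "nat \<bar>j\<bar>"]) (auto simp: idx_def)
    show "(\<lambda>m. coord (null_expansion m g) j) \<longlonglongrightarrow> coord forcing j" for j
      by (intro tendsto_eventually eventually_mono [OF ev [of j]]) (simp add: coord_forcing)
    show "norm (null_expansion m g) \<le> norm forcing" for m
      using norm_mono_coord [of "null_expansion m g" 1 forcing] by (simp add: coord_forcing)
  qed
  define D where "D m = pfield (cyclic_shift m) (null_expansion m g) v - pfield (\<lambda>j. j + 1) forcing v" for m
  have D: "D m = Complex lam \<mu> *\<^sub>C (plap (cyclic_shift m) v - Lap v) + (null_expansion m g - forcing)" for m
    by (simp add: D_def pfield_def scaleC_diff Lap_eq_plap)
  have D_le: "norm (D m) \<le> cmod (Complex lam \<mu>) * norm (plap (cyclic_shift m) v - Lap v)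
      + norm (null_expansion m g - forcing)" for m
    unfolding D norm_scaleC [symmetric] by (rule norm_triangle_ineq)
  have "(\<lambda>m. cmod (Complex lam \<mu>) * norm (plap (cyclic_shift m) v - Lap v)
      + norm (null_expansion m g - forcing)) \<longlonglongrightarrow> cmod (Complex lam \<mu>) * 0 + 0"
    by (intro tendsto_add tendsto_mult tendsto_const tendsto_norm_zero LIM_zero plap_cyclic_tendsto forcing)
  then have "D \<longlonglongrightarrow> 0"
    by (intro Lim_null_comparison [OF always_eventually [OF allI [OF D_le]]]) simp
  then have D_lim: "(\<lambda>i. norm (D (r i))) \<longlonglongrightarrow> 0"
    using LIMSEQ_subseq_LIMSEQ [OF tendsto_norm_zero r, of D] by (simp add: o_def)
  have x_lim: "(\<lambda>i. norm (x i - w)) \<longlonglongrightarrow> 0" by (intro tendsto_norm_zero LIM_zero w)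
  have pos: "1 - \<epsilon> * L > 0" using step_size(3) by simp
  have "(\<lambda>i. (norm (x i - w) + \<epsilon> * norm (D (r i))) / (1 - \<epsilon> * L)) \<longlonglongrightarrow> (0 + \<epsilon> * 0) / (1 - \<epsilon> * L)"
    using pos by (intro tendsto_divide tendsto_add tendsto_mult tendsto_const x_lim D_lim) simp
  then have lim: "(\<lambda>i. (norm (x i - w) + \<epsilon> * norm (D (r i))) / (1 - \<epsilon> * L)) \<longlonglongrightarrow> 0" by simp
  have le: "norm (trunc_step (r i) (x i) - v) \<le> (norm (x i - w) + \<epsilon> * norm (D (r i))) / (1 - \<epsilon> * L)" for i
    using step_diff_le [OF admissible_cyclic [of "r i"] admissible_shift xR [of i] wR]
    unfolding pos_le_divide_eq [OF pos] v_def D_def by (simp only: mult.commute)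
  have "(\<lambda>i. trunc_step (r i) (x i) - v) \<longlonglongrightarrow> 0"
    by (rule Lim_null_comparison [OF always_eventually [OF allI [OF le]] lim])
  then show ?thesis by (simp add: LIM_zero_iff v_def)
qed

lemma trunc_limit_set_semicontinuous:
  assumes "0 < e"
  shows "\<forall>\<^sub>F m in sequentially. \<forall>z\<in>attractor_of euclidean (\<lambda>n. trunc_step m ^^ n) (trunc_ball_ell2 m).
    \<exists>b\<in>attractor_of euclidean (\<lambda>n. full_step ^^ n) (cball 0 R). dist z b < e"
proof (rule limit_set_semicontinuous [OF closed_cball _ _ _ trunc_step_tendsto _ assms])
  fix r n :: "nat \<Rightarrow> nat" and y
  assume r: "strict_mono r" and n: "filterlim n at_top sequentially" and y: "\<And>i. y i \<in> trunc_ball_ell2 (r i)"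
  have yR: "y i \<in> cball 0 R" for i using y by (auto simp: trunc_ball_ell2_def)
  have "norm ((trunc_step (r i) ^^ n i) (y i)) \<le> R" for i
    using step_pow_in_ball [OF admissible_cyclic yR] by simp
  then obtain w s where "strict_mono s" "(\<lambda>i. (trunc_step (r (s i)) ^^ n (s i)) (y (s i))) \<longlonglongrightarrow> w"
    by (rule ell2_convergent_subseq [where x = "\<lambda>i. (trunc_step (r i) ^^ n i) (y i)",
          OF _ orbit_tails_small [OF yR n]])
  then show "\<exists>s w. strict_mono (s :: nat \<Rightarrow> nat) \<and> (\<lambda>i. (trunc_step (r (s i)) ^^ n (s i)) (y (s i))) \<longlonglongrightarrow> w"
    by blast
qed (simp add: trunc_ball_ell2_def subset_iff, rule trunc_step_in_trunc_ball, assumption,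
    rule step_in_ball [OF admissible_shift], assumption)

lemma num_attractor_eq:
  "num_attractor lam \<mu> \<gamma> \<beta> k \<nu> p g \<eta> \<epsilon> = attractor_of euclidean (\<lambda>n. full_step ^^ n) (cball 0 R)"
proof -
  have "euler (field lam \<mu> \<gamma> \<beta> k \<nu> p forcing) (cball 0 R) \<epsilon> n ` cball 0 R = (full_step ^^ n) ` cball 0 R" for n
    unfolding field_eq_pfield by (intro image_cong refl euler_eq_step_pow admissible_shift)
  then show ?thesis by (simp add: num_attractor_def attractor_of_def)
qed

end


section \<open>The truncated scheme inside the sequence space\<close>

lemma norm_null_expansion: "norm (null_expansion m z) = L2_set (\<lambda>j. cmod (z j)) (idx m)"
proof -
  have fin: "finite (idx m)" by (simp add: idx_def)
  have "((\<lambda>j. (cmod (coord (null_expansion m z) j))\<^sup>2) has_sum (\<Sum>j\<in>idx m. (cmod (z j))\<^sup>2)) UNIV"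
    by (rule has_sum_finite_neutralI [OF fin]) auto
  then have "(norm (null_expansion m z))\<^sup>2 = (\<Sum>j\<in>idx m. (cmod (z j))\<^sup>2)"
    by (rule has_sum_unique [OF norm_ell2_has_sum])
  then show ?thesis by (simp add: L2_set_def real_sqrt_unique)
qed

lemma dist_null_expansion: "dist (null_expansion m z) (null_expansion m w) = trunc_dist m z w"
proof -
  have "null_expansion m z - null_expansion m w = null_expansion m (\<lambda>j. z j - w j)"
    by (rule ell2_eqI) simp
  then show ?thesis by (simp add: dist_norm norm_null_expansion trunc_dist_def)
qed

text \<open>
  Inverse to \<^const>\<open>null_expansion\<close> between sequences supported in the window and extensional
  functions on it.
\<close>
definition restriction :: "nat \<Rightarrow> ell2 \<Rightarrow> int \<Rightarrow> complex"
  where "restriction m u = restrict (coord u) (idx m)"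

lemma restriction_in_trunc_space: "restriction m u \<in> trunc_space m"
  by (simp add: restriction_def trunc_space_def)

lemma null_expansion_restriction:
  "(\<And>j. j \<notin> idx m \<Longrightarrow> coord u j = 0) \<Longrightarrow> null_expansion m (restriction m u) = u"
  by (rule ell2_eqI) (simp add: restriction_def)

lemma restriction_null_expansion:
  "z \<in> trunc_space m \<Longrightarrow> restriction m (null_expansion m z) = z"
  by (auto simp: restriction_def trunc_space_def fun_eq_iff PiE_def extensional_def)

lemma in_trunc_topology_closure_iff:
  assumes "A \<subseteq> trunc_space m"
  shows "z \<in> trunc_topology m closure_of A
    \<longleftrightarrow> z \<in> trunc_space m \<and> (\<forall>r>0. \<exists>y\<in>A. trunc_dist m z y < r)"
proof -
  interpret Metric_space "trunc_space m" "trunc_dist m" by (rule Metric_space_trunc)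
  show ?thesis
    using assms by (auto simp: trunc_topology_def metric_closure_of) (metis subsetD)+
qed

context euler_system
begin

abbreviation tfield :: "nat \<Rightarrow> (int \<Rightarrow> complex) \<Rightarrow> int \<Rightarrow> complex"
  where "tfield m \<equiv> trunc_field lam \<mu> \<gamma> \<beta> k \<nu> p g m"

lemma null_expansion_in_trunc_ball:
  "z \<in> trunc_ball m R \<Longrightarrow> null_expansion m z \<in> trunc_ball_ell2 m"
  by (simp add: trunc_ball_def trunc_ball_ell2_def norm_null_expansion)

lemma restriction_in_trunc_ball:
  assumes "u \<in> trunc_ball_ell2 m"
  shows "restriction m u \<in> trunc_ball m R" "null_expansion m (restriction m u) = u"
proof -
  show eq: "null_expansion m (restriction m u) = u"
    using assms by (intro null_expansion_restriction) (simp add: trunc_ball_ell2_def)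
  have "norm u \<le> R" using assms by (simp add: trunc_ball_ell2_def)
  then show "restriction m u \<in> trunc_ball m R"
    using norm_null_expansion [of m "restriction m u"]
    by (simp add: eq trunc_ball_def restriction_in_trunc_space)
qed

text \<open>
  Null-expansion intertwines the truncated field with the field of the cyclic shift.
\<close>
lemma coord_pfield_null_expansion:
  "coord (pfield (cyclic_shift m) (null_expansion m g) (null_expansion m z)) j
    = (if j \<in> idx m then tfield m z j else 0)"
proof -
  have idx: "cyclic_shift m j \<in> idx m \<longleftrightarrow> j \<in> idx m" "inv (cyclic_shift m) j \<in> idx m \<longleftrightarrow> j \<in> idx m"
    by (auto simp: inv_cyclic_shift cyclic_shift_def idx_def)
  show ?thesis
  proof (cases "j \<in> idx m")
    case True
    then have "2 * z j - z (cyclic_shift m j) - z (inv (cyclic_shift m) j) = trunc_Lap m z j"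
      by (simp add: trunc_Lap_def cyclic_shift_def inv_cyclic_shift)
    with True show ?thesis
      by (simp add: coord_pfield bij_cyclic_shift idx trunc_field_def)
  qed (simp add: coord_pfield bij_cyclic_shift idx)
qed

lemma trunc_euler_equation_iff:
  "(\<forall>j\<in>idx m. z' j = z j + complex_of_real \<epsilon> * tfield m z' j) \<longleftrightarrow>
    null_expansion m z' = null_expansion m z
      + \<epsilon> *\<^sub>R pfield (cyclic_shift m) (null_expansion m g) (null_expansion m z')"
  (is "?lhs \<longleftrightarrow> ?rhs")
proof -
  have "?rhs \<longleftrightarrow> (\<forall>j. coord (null_expansion m z') j = coord (null_expansion m z) j
      + complex_of_real \<epsilon> * coord (pfield (cyclic_shift m) (null_expansion m g) (null_expansion m z')) j)"
    unfolding coord_inject [symmetric] fun_eq_iff by simp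
  also have "\<dots> \<longleftrightarrow> ?lhs"
    unfolding coord_pfield_null_expansion coord_null_expansion by auto
  finally show ?thesis by blast
qed

lemma trunc_euler_eq:
  assumes y: "y \<in> trunc_ball m R"
  shows "trunc_euler m (tfield m) (trunc_ball m R) \<epsilon> n y = restriction m ((trunc_step m ^^ n) (null_expansion m y))"
proof -
  let ?P = "\<lambda>z :: nat \<Rightarrow> int \<Rightarrow> complex. z 0 = y \<and> (\<forall>n. z n \<in> trunc_ball m R) \<and>
      (\<forall>n\<ge>1. \<forall>j\<in>idx m. z n j = z (n - 1) j + complex_of_real \<epsilon> * tfield m (z n) j)"
  define x where "x n = (trunc_step m ^^ n) (null_expansion m y)" for n
  have x: "x n \<in> trunc_ball_ell2 m" for n
    unfolding x_def by (intro trunc_step_pow_in_trunc_ball null_expansion_in_trunc_ball y)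
  then have xR: "x n \<in> cball 0 R" for n unfolding trunc_ball_ell2_def by blast
  have "(THE z. ?P z) = (\<lambda>n. restriction m (x n))"
  proof (rule the_equality)
    show "?P (\<lambda>n. restriction m (x n))"
    proof (intro conjI allI impI)
      show "restriction m (x 0) = y"
        using y by (simp add: x_def restriction_null_expansion trunc_ball_def)
      show "restriction m (x n) \<in> trunc_ball m R" for n by (rule restriction_in_trunc_ball(1) [OF x])
      fix n :: nat assume "n \<ge> 1"
      then obtain n' where n: "n = Suc n'" by (cases n) auto
      have "x (Suc n') = trunc_step m (x n')" by (simp add: x_def)
      then have "x (Suc n') = x n' + \<epsilon> *\<^sub>R pfield (cyclic_shift m) (null_expansion m g) (x (Suc n'))"
        by (simp only: step_eq [OF admissible_cyclic xR, symmetric])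
      then show "\<forall>j\<in>idx m. restriction m (x n) j
          = restriction m (x (n - 1)) j + complex_of_real \<epsilon> * tfield m (restriction m (x n)) j"
        unfolding trunc_euler_equation_iff restriction_in_trunc_ball(2) [OF x] n diff_Suc_1 .
    qed
    fix z assume z: "?P z"
    have "null_expansion m (z n) = x n" for n
    proof (induction n)
      case 0
      then show ?case using z by (simp add: x_def)
    next
      case (Suc n)
      have "null_expansion m (z i) \<in> cball 0 R" for i
        using null_expansion_in_trunc_ball z unfolding trunc_ball_ell2_def by blast
      moreover have "null_expansion m (z (Suc n)) = null_expansion m (z n)
          + \<epsilon> *\<^sub>R pfield (cyclic_shift m) (null_expansion m g) (null_expansion m (z (Suc n)))"
        unfolding trunc_euler_equation_iff [symmetric]
        using z [THEN conjunct2, THEN conjunct2, rule_format, of "Suc n"] by simp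
      ultimately have "trunc_step m (null_expansion m (z n)) = null_expansion m (z (Suc n))"
        by (intro step_unique [OF admissible_cyclic])
      with Suc show ?case by (simp add: x_def)
    qed
    moreover have "z n \<in> trunc_space m" for n using z by (auto simp: trunc_ball_def)
    ultimately show "z = (\<lambda>n. restriction m (x n))"
      by (metis restriction_null_expansion)
  qed
  then show ?thesis by (simp add: trunc_euler_def x_def)
qed

abbreviation "attr \<equiv> num_attractor lam \<mu> \<gamma> \<beta> k \<nu> p g \<eta> \<epsilon>"
abbreviation "trunc_attr \<equiv> trunc_attractor lam \<mu> \<gamma> \<beta> k \<nu> p g \<eta> \<epsilon>"

text \<open>
  Null-expansion is an isometry, so the closures that define the truncated attractor can be
  expressed by distances in the sequence space.
\<close>
lemma in_trunc_attractor_iff: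
  "z \<in> trunc_attr m \<longleftrightarrow> z \<in> trunc_space m \<and>
    (\<forall>N\<ge>1. \<forall>r>0. \<exists>n\<ge>N. \<exists>y\<in>trunc_ball m R.
      dist (null_expansion m z) ((trunc_step m ^^ n) (null_expansion m y)) < r)"
proof -
  let ?E = "trunc_euler m (tfield m) (trunc_ball m R) \<epsilon>"
  have E: "trunc_dist m z (?E n y) = dist (null_expansion m z) ((trunc_step m ^^ n) (null_expansion m y))"
    "?E n y \<in> trunc_space m" if "y \<in> trunc_ball m R" for n y
    unfolding trunc_euler_eq [OF that] dist_null_expansion [symmetric]
    by (simp_all add: restriction_in_trunc_space restriction_in_trunc_ball(2)
        trunc_step_pow_in_trunc_ball null_expansion_in_trunc_ball that)
  have sub: "(\<Union>n\<in>{N..}. ?E n ` trunc_ball m R) \<subseteq> trunc_space m" for N using E(2) by auto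
  have "z \<in> trunc_attr m \<longleftrightarrow>
      (\<forall>N\<ge>1. z \<in> trunc_topology m closure_of (\<Union>n\<in>{N..}. ?E n ` trunc_ball m R))"
    by (auto simp: trunc_attractor_def attractor_of_def Let_def)
  also have "\<dots> \<longleftrightarrow> (\<forall>N\<ge>1. z \<in> trunc_space m \<and> (\<forall>r>0. \<exists>n\<ge>N. \<exists>y\<in>trunc_ball m R.
      dist (null_expansion m z) ((trunc_step m ^^ n) (null_expansion m y)) < r))"
  proof -
    have "(\<exists>x\<in>(\<Union>n\<in>{N..}. ?E n ` trunc_ball m R). trunc_dist m z x < r) \<longleftrightarrow>
      (\<exists>n\<ge>N. \<exists>y\<in>trunc_ball m R. dist (null_expansion m z) ((trunc_step m ^^ n) (null_expansion m y)) < r)"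
      for N r by (simp add: E(1) cong: bex_cong) (simp add: Bex_def)
    then show ?thesis unfolding in_trunc_topology_closure_iff [OF sub] by simp
  qed
  finally show ?thesis by blast
qed

lemma null_expansion_trunc_attractor_subset:
  "null_expansion m ` trunc_attr m \<subseteq> attractor_of euclidean (\<lambda>n. trunc_step m ^^ n) (trunc_ball_ell2 m)"
proof (clarsimp simp: attractor_of_def closure_approachable)
  fix z N and r :: real assume "z \<in> trunc_attr m" "Suc 0 \<le> N" "0 < r"
  then obtain n y where "n \<ge> N" "y \<in> trunc_ball m R"
    "dist (null_expansion m z) ((trunc_step m ^^ n) (null_expansion m y)) < r"
    unfolding in_trunc_attractor_iff by force
  then show "\<exists>n\<in>{N..}. \<exists>u\<in>trunc_ball_ell2 m. dist ((trunc_step m ^^ n) u) (null_expansion m z) < r"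
    using null_expansion_in_trunc_ball by (auto simp: dist_commute)
qed

text \<open>
  The supremum of the empty set of extended reals is \<open>- \<infinity>\<close>, so the semidistance is nonnegative only
  because the truncated attractor has a point: a limit point of the orbit of \<open>0\<close>, which stays in
  a bounded set of sequences supported in the window.
\<close>
lemma trunc_attractor_nonempty: "trunc_attr m \<noteq> {}"
proof -
  define x where "x n = (trunc_step m ^^ n) 0" for n
  have "0 \<in> trunc_ball_ell2 m" by (simp add: trunc_ball_ell2_def R_nonneg)
  then have x: "x n \<in> trunc_ball_ell2 m" for n unfolding x_def by (rule trunc_step_pow_in_trunc_ball)
  then have xR: "norm (x n) \<le> R" and x0: "j \<notin> idx m \<Longrightarrow> coord (x n) j = 0" for n j
    by (auto simp: trunc_ball_ell2_def)
  have "indicat_real (- idx m) j * (cmod (coord (x n) j))\<^sup>2 = 0" for n j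
    using x0 [of j n] by (cases "j \<in> idx m") simp_all
  then have "tail (idx m) (x n) = 0" for n unfolding wsum_def by (intro infsum_0)
  then have "\<exists>J. finite J \<and> (\<forall>\<^sub>F n in sequentially. tail J (x n) \<le> e)" if "0 < e" for e
    using that by (intro exI [of _ "idx m"]) (simp add: idx_def)
  then obtain w s where s: "strict_mono s" and w: "(\<lambda>i. x (s i)) \<longlonglongrightarrow> w"
    using ell2_convergent_subseq [of x R] xR by metis
  have "coord w j = 0" if "j \<notin> idx m" for j
    using coord_tendsto [OF w, of j] x0 [OF that] by (simp add: LIMSEQ_const_iff)
  then have w_eq: "null_expansion m (restriction m w) = w" by (rule null_expansion_restriction)
  have "restriction m w \<in> trunc_attr m"
    unfolding in_trunc_attractor_iff w_eq
  proof (intro conjI allI impI restriction_in_trunc_space)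
    fix N :: nat and r :: real assume "0 < r"
    with tendstoD [OF w] obtain I where "\<forall>i\<ge>I. dist (x (s i)) w < r"
      by (auto simp: eventually_sequentially)
    moreover have "N \<le> s (max I N)" using seq_suble [OF s, of "max I N"] by simp
    moreover have "x n = (trunc_step m ^^ n) (null_expansion m (restriction m 0))" for n
      by (simp add: x_def null_expansion_restriction)
    ultimately show "\<exists>n\<ge>N. \<exists>y\<in>trunc_ball m R. dist w ((trunc_step m ^^ n) (null_expansion m y)) < r"
      using restriction_in_trunc_ball(1) [OF \<open>0 \<in> trunc_ball_ell2 m\<close>]
      by (metis dist_commute max.cobounded1)
  qed
  then show ?thesis by blast
qed

lemma semidist_tendsto: "(\<lambda>m. semidist (null_expansion m ` trunc_attr m) attr) \<longlonglongrightarrow> 0"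
proof (rule order_tendstoI)
  have nonneg: "0 \<le> semidist (null_expansion m ` trunc_attr m) attr" for m
  proof -
    obtain z where "z \<in> trunc_attr m" using trunc_attractor_nonempty by blast
    then have "(INF b\<in>attr. ereal (dist (null_expansion m z) b)) \<le> semidist (null_expansion m ` trunc_attr m) attr"
      unfolding semidist_def by (intro SUP_upper imageI)
    moreover have "0 \<le> (INF b\<in>attr. ereal (dist (null_expansion m z) b))" by (intro INF_greatest) simp
    ultimately show ?thesis by (rule order_trans [rotated])
  qed
  show "\<forall>\<^sub>F m in sequentially. a < semidist (null_expansion m ` trunc_attr m) attr" if "a < 0" for a
    using less_le_trans [OF that nonneg] by (intro always_eventually) blast
  show "\<forall>\<^sub>F m in sequentially. semidist (null_expansion m ` trunc_attr m) attr < a" if pos: "0 < a" for a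
  proof -
    obtain e where e: "0 < ereal e" "ereal e < a" using ereal_dense2 [OF pos] by blast
    then have "0 < e" by simp
    from trunc_limit_set_semicontinuous [OF this] show ?thesis
    proof eventually_elim
      case (elim m)
      have "semidist (null_expansion m ` trunc_attr m) attr \<le> ereal e"
        unfolding semidist_def
      proof (rule SUP_least)
        fix u assume "u \<in> null_expansion m ` trunc_attr m"
        then obtain b where "b \<in> attr" "dist u b < e"
          using elim null_expansion_trunc_attractor_subset unfolding num_attractor_eq by blast
        then show "(INF b\<in>attr. ereal (dist u b)) \<le> ereal e" by (intro INF_lower2) auto
      qed
      then show ?case using e(2) by (rule le_less_trans)
    qed
  qed
qed

end

theorem theorem4p2:
  fixes lam \<mu> \<gamma> \<beta> k \<nu> p \<eta> Cp \<epsilon> :: real and g :: "int \<Rightarrow> complex"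
  assumes "lam > 0" "\<gamma> > 0" "k > 0" "p > 0" "\<gamma> > 4 * lam"
    and "(\<lambda>j. cmod (g j) powr ((p + 2) / (p + 1))) summable_on UNIV"
    and "Cp > 0"
    and "\<forall>r>0. \<forall>u\<in>cball 0 r. \<forall>v\<in>cball 0 r.
           norm (nonlin p u - nonlin p v) \<le> Cp * r powr p * norm (u - v)"
    and "\<eta> \<ge> 0"
    and "\<epsilon> \<in> {0<..eps_star lam \<mu> \<gamma> \<beta> k \<nu> p g Cp \<eta>}"
  shows "(\<lambda>m. semidist (null_expansion m ` trunc_attractor lam \<mu> \<gamma> \<beta> k \<nu> p g \<eta> \<epsilon> m)
                       (num_attractor lam \<mu> \<gamma> \<beta> k \<nu> p g \<eta> \<epsilon>)) \<longlonglongrightarrow> 0"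
proof -
  interpret euler_system lam \<mu> \<gamma> \<beta> k \<nu> p g \<eta> Cp \<epsilon>
    using assms by unfold_locales auto
  show ?thesis by (rule semidist_tendsto)
qed

end
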